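(* Let $w$ be a weight on $\mathbb{R}^n$ and $M$ the Hardy–Littlewood maximal operator. (a) Let $1<p<\infty$. $M$ is bounded on $\mathcal{LM}^{p}(\varphi,w)$ if and only if $w\in A(\mathcal{LM}^{p}(\varphi))$. (b) Let $1\le p<\infty$. $M$ is bounded from $\mathcal{LM}^{p}(\varphi,w)$ to $W\mathcal{LM}^{p}(\varphi,w)$ if and only if $w\in A(\mathcal{LM}^{p}(\varphi))$. Moreover, the operator norm is comparable to $[w]_{A(\mathcal{LM}^{p}(\varphi))}$, with constants independent of $w$.
   Context: A weight is a nonnegative locally integrable function on $\mathbb{R}^n$. Let $\varphi$ be a function from the set of Euclidean balls of $\mathbb{R}^n$ to $(0,\infty)$; standing assumptions: $\varphi$ is doubling ($\varphi(2B)\le C\varphi(B)$) and reverse doubling (there are $\delta>0$, $C$ with $\varphi(B_1)/\varphi(B_2)\le C(|B_1|/|B_2|)^\delta$ for balls $B_1\subset B_2$), and characteristic functions of balls belong to the Morrey spaces considered. The weighted local Morrey space $\mathcal{LM}^{p}(\varphi,w)$ ($1\le p<\infty$) consists of measurable $f$ with $\|f\|_{\mathcal{LM}^{p}(\varphi,w)}:=\sup_{R>0}\big(\varphi(B(0,R))^{-1}\int_{B(0,R)}|f|^pw\big)^{1/p}<\infty$; $W\mathcal{LM}^{p}(\varphi,w)$ consists of $f$ with $\sup_{R>0}\sup_{t>0}t\,w(\{x\in B(0,R):|f(x)|>t\})^{1/p}\varphi(B(0,R))^{-1/p}<\infty$. The Köthe dual $X'$ of a Banach lattice $X$ has norm $\|g\|_{X'}:=\sup\{\int|fg|:\|f\|_X\le1\}$.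 $[w]_{A(\mathcal{LM}^{p}(\varphi))}:=\sup_B\|\chi_B\|_{\mathcal{LM}^{p}(\varphi,w)}\|\chi_B\|_{\mathcal{LM}^{p}(\varphi,w)'}/|B|$, supremum over all balls in $\mathbb{R}^n$, and $A(\mathcal{LM}^{p}(\varphi))$ is the class where it is finite. *)

theory Defs
  imports "HOL-Analysis.Analysis"
begin

text \<open>Real powers of extended nonnegative reals (with \<open>top powr a = top\<close>, meant for \<open>a > 0\<close>).\<close>
definition epowr :: "ennreal \<Rightarrow> real \<Rightarrow> ennreal" where
  "epowr x a = (if x = top then top else ennreal (enn2real x powr a))"

definition is_ball :: "'a::euclidean_space set \<Rightarrow> bool" where
  "is_ball B \<longleftrightarrow> (\<exists>c r. r > 0 \<and> B = ball c r)"

text \<open>Standing assumptions on \<open>\<phi>\<close> (only its values on balls matter).\<close>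
definition admissible_phi :: "('a::euclidean_space set \<Rightarrow> real) \<Rightarrow> bool" where
  "admissible_phi \<phi> \<longleftrightarrow>
     (\<forall>B. is_ball B \<longrightarrow> \<phi> B > 0) \<and>
     (\<exists>C. \<forall>c r. r > 0 \<longrightarrow> \<phi> (ball c (2 * r)) \<le> C * \<phi> (ball c r)) \<and>
     (\<exists>\<delta> C. \<delta> > 0 \<and> (\<forall>B1 B2. is_ball B1 \<longrightarrow> is_ball B2 \<longrightarrow> B1 \<subseteq> B2 \<longrightarrow>
        \<phi> B1 / \<phi> B2 \<le> C * (measure lebesgue B1 / measure lebesgue B2) powr \<delta>))"

definition weight :: "('a::euclidean_space \<Rightarrow> real) \<Rightarrow> bool" where
  "weight w \<longleftrightarrow> w \<in> borel_measurable lebesgue \<and> (\<forall>x. w x \<ge> 0) \<and>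
     (\<forall>c r. set_integrable lebesgue (ball c r) w)"

definition LM_norm :: "real \<Rightarrow> ('a::euclidean_space set \<Rightarrow> real) \<Rightarrow> ('a \<Rightarrow> real)
    \<Rightarrow> ('a \<Rightarrow> ennreal) \<Rightarrow> ennreal" where
  "LM_norm p \<phi> w g = (SUP R\<in>{0<..}.
     epowr ((\<integral>\<^sup>+ x\<in>ball 0 R. epowr (g x) p * ennreal (w x) \<partial>lebesgue)
              / ennreal (\<phi> (ball 0 R))) (1 / p))"

definition WLM_norm :: "real \<Rightarrow> ('a::euclidean_space set \<Rightarrow> real) \<Rightarrow> ('a \<Rightarrow> real)
    \<Rightarrow> ('a \<Rightarrow> ennreal) \<Rightarrow> ennreal" where
  "WLM_norm p \<phi> w g = (SUP R\<in>{0<..}. SUP t\<in>{0<..}.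
     ennreal t * epowr ((\<integral>\<^sup>+ x\<in>{x \<in> ball 0 R. g x > ennreal t}. ennreal (w x) \<partial>lebesgue)
              / ennreal (\<phi> (ball 0 R))) (1 / p))"

abbreviation absf :: "('a \<Rightarrow> real) \<Rightarrow> 'a \<Rightarrow> ennreal" where
  "absf f \<equiv> (\<lambda>x. ennreal \<bar>f x\<bar>)"

definition LM_dual_norm :: "real \<Rightarrow> ('a::euclidean_space set \<Rightarrow> real) \<Rightarrow> ('a \<Rightarrow> real)
    \<Rightarrow> ('a \<Rightarrow> real) \<Rightarrow> ennreal" where
  "LM_dual_norm p \<phi> w g = (SUP f\<in>{f \<in> borel_measurable lebesgue. LM_norm p \<phi> w (absf f) \<le> 1}.
     \<integral>\<^sup>+ x. ennreal \<bar>f x * g x\<bar> \<partial>lebesgue)"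

definition A_const :: "real \<Rightarrow> ('a::euclidean_space set \<Rightarrow> real) \<Rightarrow> ('a \<Rightarrow> real) \<Rightarrow> ennreal" where
  "A_const p \<phi> w = (SUP B\<in>{B. is_ball B}.
     LM_norm p \<phi> w (absf (indicator B)) * LM_dual_norm p \<phi> w (indicator B)
       / emeasure lebesgue B)"

definition A_class :: "real \<Rightarrow> ('a::euclidean_space set \<Rightarrow> real) \<Rightarrow> ('a \<Rightarrow> real) \<Rightarrow> bool" where
  "A_class p \<phi> w \<longleftrightarrow> A_const p \<phi> w < top"

definition maximal :: "('a::euclidean_space \<Rightarrow> real) \<Rightarrow> 'a \<Rightarrow> ennreal" where
  "maximal f x = (SUP B\<in>{B. is_ball B \<and> x \<in> B}.
     (\<integral>\<^sup>+ y\<in>B. ennreal \<bar>f y\<bar> \<partial>lebesgue) / emeasure lebesgue B)"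

definition M_bounded_LM :: "real \<Rightarrow> ('a::euclidean_space set \<Rightarrow> real) \<Rightarrow> ('a \<Rightarrow> real) \<Rightarrow> bool" where
  "M_bounded_LM p \<phi> w \<longleftrightarrow> (\<exists>C::real. \<forall>f \<in> borel_measurable lebesgue.
     LM_norm p \<phi> w (absf f) < top \<longrightarrow>
     LM_norm p \<phi> w (maximal f) \<le> ennreal C * LM_norm p \<phi> w (absf f))"

definition M_bounded_WLM :: "real \<Rightarrow> ('a::euclidean_space set \<Rightarrow> real) \<Rightarrow> ('a \<Rightarrow> real) \<Rightarrow> bool" where
  "M_bounded_WLM p \<phi> w \<longleftrightarrow> (\<exists>C::real. \<forall>f \<in> borel_measurable lebesgue.
     LM_norm p \<phi> w (absf f) < top \<longrightarrow>
     WLM_norm p \<phi> w (maximal f) \<le> ennreal C * LM_norm p \<phi> w (absf f))"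

definition M_opnorm_WLM :: "real \<Rightarrow> ('a::euclidean_space set \<Rightarrow> real) \<Rightarrow> ('a \<Rightarrow> real) \<Rightarrow> ennreal" where
  "M_opnorm_WLM p \<phi> w = (SUP f\<in>{f \<in> borel_measurable lebesgue. LM_norm p \<phi> w (absf f) \<le> 1}.
     WLM_norm p \<phi> w (maximal f))"

end

theory Submission
  imports Defs
begin

text \<open>
  Write K for the A-constant and \<open>\<parallel>\<cdot>\<parallel>\<close> for the local Morrey norm. Testing the weak type inequality
  on a ball B where Mf exceeds the mean of f gives K \<open>\<le>\<close> operator norm. Conversely, the A-condition says
  that the mean of |f| over a ball B times the norm of the characteristic function of B is at most
  \<open>K \<parallel>f\<parallel>\<close>. Balls B(c,r) are split according to whether 16 r < |c|.

  If not, B(c,r) lies in B(0,17r), and only means over balls centred at 0 matter. There the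
  A-condition gives the weak bound at once; for the strong bound it also makes the norm of the
  characteristic function of B(0,s) doubling in s, and the contributions of dyadic annuli are summed
  using reverse doubling of \<open>\<phi>\<close>.

  If 16 r < |c|, then \<open>\<phi>\<close> is essentially constant at the scale |c|, and the A-condition reduces to the
  Muckenhoupt condition for w on such balls. The weak bound follows by Vitali covering with
  a constant linear in K. The strong bound for p > 1 follows Lerner: with
  \<open>\<sigma> = w\<^bsup>-1/(p-1)\<^esup>\<close>, the local maximal function to the power p - 1 is dominated by
  \<open>M\<^sub>w (M\<^sub>\<sigma> (f/\<sigma>)\<^bsup>p-1\<^esup> / w)\<close>, where the weighted maximal operators divide by the measure of the
  dilated ball 5B, so that they are bounded on weighted Lebesgue spaces without any doubling.
\<close>


subsection \<open>Powers and division of extended nonnegative reals\<close>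

text \<open>The weak operator norm is compared with K by constants free of w, so the weak bound has
  to be linear in K. The A-condition does make w doubling on balls far from the origin, but with a
  constant that involves K; using it to pass from B to the fivefold ball 5B of the Vitali lemma
  would destroy the linearity. The way out is to apply the A-condition on 5B to f times the
  characteristic function of B. The dilation then costs only 5^n, n being the dimension, through
  Lebesgue measure. The strong bound is under no such demand: K enters there with higher powers, for
  instance squared in the part of the central balls. A second obstacle is degeneracy. The dual
  weight makes no sense where w = 0, yet w = 0 is a legitimate weight with K = 0, because 0 times
  \<open>top\<close> is 0. What saves the argument is that a finite K forces w to vanish either
  almost everywhere or almost nowhere.\<close>

lemma epowr_top [simp]: "epowr top a = top"
  by (simp add: epowr_def)

lemma epowr_0 [simp]: "epowr 0 a = 0"
  by (simp add: epowr_def)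

lemma epowr_ennreal: "0 \<le> x \<Longrightarrow> epowr (ennreal x) a = ennreal (x powr a)"
  by (simp add: epowr_def)

lemma epowr_one [simp]: "epowr x 1 = x"
  by (cases x) (auto simp: epowr_ennreal powr_one_gt_zero_iff)

lemma epowr_1 [simp]: "epowr 1 a = 1"
  by (simp add: epowr_def)

lemma epowr_eq_0_iff [simp]: "epowr x a = 0 \<longleftrightarrow> x = 0"
  by (cases x) (auto simp: epowr_ennreal)

lemma epowr_eq_top_iff [simp]: "epowr x a = top \<longleftrightarrow> x = top"
  by (simp add: epowr_def)

lemma epowr_mono: "x \<le> y \<Longrightarrow> 0 \<le> a \<Longrightarrow> epowr x a \<le> epowr y a"
  by (cases x; cases y) (auto simp: epowr_ennreal top_unique intro!: powr_mono2)

text \<open>The conventions that every power of 0 is 0 and every power of \<open>top\<close> is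
  \<open>top\<close> are multiplicative, so this law and the two below hold for exponents of either
  sign.\<close>

lemma epowr_mult: "epowr (x * y) a = epowr x a * epowr y a"
  by (cases x; cases y; cases "x = 0"; cases "y = 0")
     (auto simp: epowr_ennreal powr_mult ennreal_mult[symmetric] ennreal_mult_top ennreal_top_mult)

lemma epowr_epowr: "epowr (epowr x a) b = epowr x (a * b)"
  by (cases x) (auto simp: epowr_ennreal powr_powr)

lemma epowr_add: "epowr x a * epowr x b = epowr x (a + b)"
  by (cases x) (auto simp: epowr_ennreal powr_add ennreal_mult[symmetric] ennreal_mult_top)

lemma epowr_le_iff: "0 < a \<Longrightarrow> epowr x a \<le> y \<longleftrightarrow> x \<le> epowr y (1 / a)"
  using epowr_mono[of "epowr x a" y "1 / a"] epowr_mono[of x "epowr y (1 / a)" a]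
  by (auto simp: epowr_epowr)

lemma epowr_divide: "0 < c \<Longrightarrow> epowr (x / ennreal c) a = epowr x a / ennreal (c powr a)"
  by (simp add: divide_ennreal_def inverse_ennreal epowr_mult epowr_ennreal
      inverse_powr powr_minus)

lemma borel_measurable_epowr [measurable]:
  "f \<in> borel_measurable M \<Longrightarrow> (\<lambda>x. epowr (f x) a) \<in> borel_measurable M"
proof -
  assume [measurable]: "f \<in> borel_measurable M"
  have "{x \<in> space M. f x = top} = f -` {top} \<inter> space M"
    by auto
  also have "\<dots> \<in> sets M"
    by measurable
  finally have [measurable]: "{x \<in> space M. f x = top} \<in> sets M" .
  show ?thesis
    unfolding epowr_def by (intro measurable_If borel_measurable_const) simp_all
qed

lemma divide_le_iff_ennreal:
  fixes x y z :: ennreal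
  shows "0 < z \<Longrightarrow> z < top \<Longrightarrow> x / z \<le> y \<longleftrightarrow> x \<le> y * z"
  by (cases x; cases y; cases z)
     (auto simp: divide_ennreal ennreal_mult[symmetric] field_simps ennreal_top_mult ennreal_top_divide top_unique)

text \<open>The condition on \<open>z = 0\<close> excludes the quotient \<open>top\<close>; for
  \<open>z = top\<close> the quotient is 0, which lies above no \<open>t\<close>.\<close>

lemma less_divideD_ennreal:
  fixes t x z :: ennreal
  assumes "t < x / z" "z = 0 \<Longrightarrow> x = 0"
  shows "t * z \<le> x"
proof -
  have "z \<noteq> 0" "z \<noteq> top"
    using assms by auto
  then show ?thesis
    using assms(1) divide_le_iff_ennreal[of z x t] by (auto simp: not_le less_top zero_less_iff_neq_zero)
qed

subsection \<open>Covering and layer cake\<close>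

text \<open>Wanted for Fubini in the layer cake argument.\<close>

lemma sigma_finite_lebesgue: "sigma_finite_measure (lebesgue :: 'a::euclidean_space measure)"
proof
  show "\<exists>A::'a set set. countable A \<and> A \<subseteq> sets lebesgue \<and> \<Union>A = space lebesgue \<and>
      (\<forall>a\<in>A. emeasure lebesgue a \<noteq> \<infinity>)"
  proof (intro exI conjI)
    show "countable (range (\<lambda>n::nat. ball (0::'a) (real n)))"
      by simp
    show "(\<Union>n::nat. ball (0::'a) (real n)) = space lebesgue"
      by (auto simp: reals_Archimedean2)
    show "\<forall>a\<in>range (\<lambda>n::nat. ball (0::'a) (real n)). emeasure lebesgue a \<noteq> \<infinity>"
      by (auto simp: emeasure_ball)
  qed auto
qed

lemma emeasure_lebesgue_ball_scale:
  assumes "0 \<le> r" "0 \<le> a"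
  shows "emeasure lebesgue (ball (c::'a::euclidean_space) (a * r))
    = ennreal (a ^ DIM('a)) * emeasure lebesgue (ball (d::'a) r)"
  using assms
  by (simp add: emeasure_ball power_mult_distrib ennreal_mult[symmetric] mult_ac)

lemma emeasure_lebesgue_ball_pos:
  assumes "0 < r"
  shows "0 < emeasure lebesgue (ball (c::'a::euclidean_space) r)"
proof -
  have "0 < measure lborel (ball c r)"
    using assms by simp
  then show ?thesis
    by (simp add: measure_def enn2real_positive_iff)
qed

lemma emeasure_lebesgue_ball_finite: "emeasure lebesgue (ball (c::'a::euclidean_space) r) < top"
  using emeasure_lborel_ball_finite[of c r] by simp

lemma ball_in_sets_lebesgue [measurable]: "ball (c::'a::euclidean_space) r \<in> sets lebesgue"
  by simp

text \<open>Each superlevel set is the union of those open sets whose value exceeds the level, so an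
  uncountable index set does no harm.\<close>

lemma measurable_SUP_open:
  fixes v :: "'i \<Rightarrow> ennreal" and U :: "'i \<Rightarrow> 'a::topological_space set"
  assumes "\<And>i. i \<in> I \<Longrightarrow> open (U i)"
  shows "(\<lambda>x. SUP i\<in>{i \<in> I. x \<in> U i}. v i) \<in> borel_measurable borel"
proof (rule borel_measurableI_greater)
  fix y
  have "{x \<in> space borel. y < (SUP i\<in>{i \<in> I. x \<in> U i}. v i)} = (\<Union>i\<in>{i \<in> I. y < v i}. U i)"
    by (auto simp: less_SUP_iff)
  moreover have "open \<dots>"
    using assms by auto
  ultimately show "{x \<in> space borel. y < (SUP i\<in>{i \<in> I. x \<in> U i}. v i)} \<in> sets borel"
    by simp
qed

text \<open>The fivefold dilates of a disjoint subfamily cover the union, and \<open>le\<close>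
  charges the integral of u over each dilate to the integral of v over its own ball. The charged
  balls are disjoint, so the total is at most the integral of v. The comparison of a dilate with its
  ball takes the place of doubling.\<close>

lemma Vitali_nn_integral_le:
  fixes c :: "'i \<Rightarrow> 'a::euclidean_space" and u v :: "'a \<Rightarrow> ennreal"
  assumes u [measurable]: "u \<in> borel_measurable lebesgue"
    and v [measurable]: "v \<in> borel_measurable lebesgue"
    and r: "\<And>i. i \<in> I \<Longrightarrow> 0 < r i \<and> r i \<le> L"
    and le: "\<And>i. i \<in> I \<Longrightarrow> (\<integral>\<^sup>+x\<in>ball (c i) (5 * r i). u x \<partial>lebesgue) \<le> (\<integral>\<^sup>+x\<in>ball (c i) (r i). v x \<partial>lebesgue)"
  shows "(\<integral>\<^sup>+x\<in>(\<Union>i\<in>I. ball (c i) (r i)). u x \<partial>lebesgue) \<le> (\<integral>\<^sup>+x. v x \<partial>lebesgue)"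
proof -
  obtain C where C: "countable C" "C \<subseteq> I"
     "pairwise (\<lambda>i j. disjnt (ball (c i) (r i)) (ball (c j) (r j))) C"
     "(\<Union>i\<in>I. ball (c i) (r i)) \<subseteq> (\<Union>i\<in>C. ball (c i) (5 * r i))"
    by (rule Vitali_covering_lemma_balls[OF subset_refl, where K=I and a=c and r=r and B=L])
       (use r in auto)
  have dis: "disjoint_family_on (\<lambda>i. ball (c i) (r i)) C"
    using C(3) by (auto simp: disjoint_family_on_def pairwise_def disjnt_def)
  \<comment> \<open>As a measure, v turns the sum over the disjoint balls into the mass of their
    union.\<close>
  let ?E = "density lebesgue v"
  have "(\<integral>\<^sup>+x\<in>(\<Union>i\<in>I. ball (c i) (r i)). u x \<partial>lebesgue)
    \<le> (\<integral>\<^sup>+x. (\<integral>\<^sup>+i. u x * indicator (ball (c i) (5 * r i)) x \<partial>count_space C) \<partial>lebesgue)"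
  proof (rule nn_integral_mono)
    fix x
    show "u x * indicator (\<Union>i\<in>I. ball (c i) (r i)) x
      \<le> (\<integral>\<^sup>+i. u x * indicator (ball (c i) (5 * r i)) x \<partial>count_space C)"
    proof (cases "x \<in> (\<Union>i\<in>I. ball (c i) (r i))")
      case True
      then obtain j where "j \<in> C" "x \<in> ball (c j) (5 * r j)"
        using C(4) by blast
      then show ?thesis
        using nn_integral_ge_point[of j C "\<lambda>i. u x * indicator (ball (c i) (5 * r i)) x"] True
        by auto
    qed auto
  qed
  also have "\<dots> = (\<integral>\<^sup>+i. (\<integral>\<^sup>+x\<in>ball (c i) (5 * r i). u x \<partial>lebesgue) \<partial>count_space C)"
    by (intro nn_integral_count_space_nn_integral C) measurable
  also have "\<dots> \<le> (\<integral>\<^sup>+i. emeasure ?E (ball (c i) (r i)) \<partial>count_space C)"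
    using C(2) le by (intro nn_integral_mono) (auto simp: emeasure_density)
  also have "\<dots> = emeasure ?E (\<Union>i\<in>C. ball (c i) (r i))"
    by (rule emeasure_UN_countable[symmetric]) (auto intro!: C dis)
  also have "\<dots> \<le> emeasure ?E (space lebesgue)"
    by (rule emeasure_mono) auto
  also have "\<dots> = (\<integral>\<^sup>+x. v x \<partial>lebesgue)"
    by (subst emeasure_density) auto
  finally show ?thesis .
qed

text \<open>The bound -1 < a gives integrability at 0 and divergence at infinity. The latter makes
  the formula true for m = \<open>top\<close>, a value that maximal functions may take.\<close>

lemma layer_cake_power:
  assumes "-1 < a"
  shows "(\<integral>\<^sup>+t\<in>{0<..}. ennreal (t powr a) * (if ennreal t < m then 1 else 0) \<partial>lborel)
    = epowr m (a + 1) / ennreal (a + 1)"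
proof -
  have fin: "(\<integral>\<^sup>+t\<in>{0<..}. ennreal (t powr a) * (if ennreal t < ennreal c then 1 else 0) \<partial>lborel)
    = ennreal (c powr (a + 1) / (a + 1))" if "0 \<le> c" for c
  proof -
    have "(\<integral>\<^sup>+t\<in>{0<..}. ennreal (t powr a) * (if ennreal t < ennreal c then 1 else 0) \<partial>lborel)
      = (\<integral>\<^sup>+t. ennreal (t powr a) * indicator {0..c} t \<partial>lborel)"
    proof (rule nn_integral_cong_AE)
      have "AE t in lborel. t \<noteq> c" "AE t in lborel. t \<noteq> (0::real)"
        by (auto intro: AE_lborel_singleton)
      then show "AE t in lborel. ennreal (t powr a) * (if ennreal t < ennreal c then 1 else 0) * indicator {0<..} t
        = ennreal (t powr a) * indicator {0..c} t"
        by eventually_elim (auto simp: indicator_def ennreal_less_iff)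
    qed
    also have "\<dots> = ennreal (c powr (a + 1) / (a + 1))"
      using has_integral_powr_from_0[OF assms that]
      by (intro nn_integral_has_integral_lebesgue') auto
    finally show ?thesis .
  qed
  show ?thesis
  proof (cases m)
    case (real c)
    then show ?thesis
      using assms fin[of c] by (simp add: epowr_ennreal divide_ennreal)
  next
    case top
    have "(\<integral>\<^sup>+t\<in>{0<..}. ennreal (t powr a) * (if ennreal t < m then 1 else 0) \<partial>lborel) \<ge> ennreal N"
      if "0 \<le> N" for N
    proof -
      \<comment> \<open>The finite level is chosen so that its layer cake integral is exactly
        N.\<close>
      have "ennreal N = ennreal ((((a + 1) * N) powr (1 / (a + 1))) powr (a + 1) / (a + 1))"
        using that assms by (simp add: powr_powr)
      also have "\<dots> = (\<integral>\<^sup>+t\<in>{0<..}. ennreal (t powr a) *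
          (if ennreal t < ennreal (((a + 1) * N) powr (1 / (a + 1))) then 1 else 0) \<partial>lborel)"
        by (rule fin[symmetric]) simp
      also have "\<dots> \<le> (\<integral>\<^sup>+t\<in>{0<..}. ennreal (t powr a) * (if ennreal t < m then 1 else 0) \<partial>lborel)"
        using top by (intro nn_integral_mono mult_mono) auto
      finally show ?thesis .
    qed
    then have "(\<integral>\<^sup>+t\<in>{0<..}. ennreal (t powr a) * (if ennreal t < m then 1 else 0) \<partial>lborel) = top"
      (is "?I = top")
    proof (cases ?I)
      case (real r)
      then have "ennreal (r + 1) \<le> ennreal r"
        using \<open>\<And>N. 0 \<le> N \<Longrightarrow> ennreal N \<le> ?I\<close>[of "r + 1"] by simp
      then show ?thesis
        using real by (simp add: ennreal_le_iff)
    qed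
    then show ?thesis
      using top assms by (simp add: ennreal_top_divide)
  qed
qed

text \<open>u vanishes almost everywhere on A, and 0 absorbs the factor g even where g is
  \<open>top\<close>. This settles quotients with denominator 0.\<close>

lemma nn_integral_zero_subset:
  fixes u g :: "'a \<Rightarrow> ennreal"
  assumes [measurable]: "u \<in> borel_measurable M" "A \<in> sets M"
    and "(\<integral>\<^sup>+x\<in>A. u x \<partial>M) = 0" "B \<subseteq> A"
  shows "(\<integral>\<^sup>+x\<in>B. g x * u x \<partial>M) = 0"
proof -
  have "AE x in M. u x * indicator A x = 0"
    using assms(3) by (subst (asm) nn_integral_0_iff_AE) auto
  then have "AE x in M. g x * u x * indicator B x = 0"
    by eventually_elim (use assms(4) in \<open>auto simp: indicator_def split: if_splits\<close>)
  then have "(\<integral>\<^sup>+x\<in>B. g x * u x \<partial>M) = (\<integral>\<^sup>+x. 0 \<partial>M)"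
    by (rule nn_integral_cong_AE)
  then show ?thesis
    by simp
qed

subsection \<open>Maximal operators with dilated denominators\<close>

text \<open>The junk values cause no trouble: if the denominator is \<open>0\<close>, so is the numerator, and
  \<open>x / top = 0\<close>.\<close>

definition dilated_maximal ::
    "('a::euclidean_space \<times> real) set \<Rightarrow> ('a \<Rightarrow> ennreal) \<Rightarrow> ('a \<Rightarrow> ennreal) \<Rightarrow> 'a \<Rightarrow> ennreal" where
  "dilated_maximal F u g x = (SUP i\<in>{i \<in> F. x \<in> ball (fst i) (snd i)}.
     (\<integral>\<^sup>+y\<in>ball (fst i) (snd i). g y * u y \<partial>lebesgue)
       / (\<integral>\<^sup>+y\<in>ball (fst i) (5 * snd i). u y \<partial>lebesgue))"

lemma dilated_maximal_measurable [measurable]: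
  "dilated_maximal F u g \<in> borel_measurable lebesgue"
  unfolding dilated_maximal_def
  by (rule measurable_completion, unfold measurable_lborel2, rule measurable_SUP_open) simp

text \<open>The denominator is the mass of the fivefold ball, so a quotient above t is just what
  \<open>Vitali_nn_integral_le\<close> asks for. Hence the constant is 1 for every u, and the bound
  L on the radii does not enter it.\<close>

lemma dilated_maximal_weak_type:
  fixes F :: "('a::euclidean_space \<times> real) set"
  assumes [measurable]: "u \<in> borel_measurable lebesgue" "g \<in> borel_measurable lebesgue"
    and r: "\<And>i. i \<in> F \<Longrightarrow> 0 < snd i \<and> snd i \<le> L"
  shows "t * (\<integral>\<^sup>+x\<in>{x. t < dilated_maximal F u g x}. u x \<partial>lebesgue) \<le> (\<integral>\<^sup>+x. g x * u x \<partial>lebesgue)"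
proof -
  let ?q = "\<lambda>i. (\<integral>\<^sup>+y\<in>ball (fst i) (snd i). g y * u y \<partial>lebesgue)
       / (\<integral>\<^sup>+y\<in>ball (fst i) (5 * snd i). u y \<partial>lebesgue)"
  let ?J = "{i \<in> F. t < ?q i}"
  define U where "U = (\<Union>i\<in>?J. ball (fst i) (snd i))"
  have eq: "{x. t < dilated_maximal F u g x} = U"
    unfolding U_def dilated_maximal_def less_SUP_iff by blast
  have "open U"
    by (auto simp: U_def)
  then have [measurable]: "U \<in> sets lebesgue"
    by simp
  have "t * (\<integral>\<^sup>+x\<in>{x. t < dilated_maximal F u g x}. u x \<partial>lebesgue)
    = (\<integral>\<^sup>+x\<in>U. t * u x \<partial>lebesgue)"
    unfolding eq mult.assoc by (rule nn_integral_cmult[symmetric]) measurable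
  also have "\<dots> \<le> (\<integral>\<^sup>+x. g x * u x \<partial>lebesgue)"
    unfolding U_def
  proof (rule Vitali_nn_integral_le)
    fix i assume i: "i \<in> ?J"
    then have pos: "0 < snd i"
      using r by auto
    have "(\<integral>\<^sup>+x\<in>ball (fst i) (5 * snd i). t * u x \<partial>lebesgue)
      = t * (\<integral>\<^sup>+x\<in>ball (fst i) (5 * snd i). u x \<partial>lebesgue)"
      unfolding mult.assoc by (rule nn_integral_cmult) measurable
    also have "\<dots> \<le> (\<integral>\<^sup>+x\<in>ball (fst i) (snd i). g x * u x \<partial>lebesgue)"
    proof (rule less_divideD_ennreal)
      show "t < ?q i"
        using i by simp
      assume "(\<integral>\<^sup>+x\<in>ball (fst i) (5 * snd i). u x \<partial>lebesgue) = 0"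
      then show "(\<integral>\<^sup>+x\<in>ball (fst i) (snd i). g x * u x \<partial>lebesgue) = 0"
        by (rule nn_integral_zero_subset[rotated 2]) (use pos in \<open>auto intro!: subset_ball\<close>)
    qed
    finally show "(\<integral>\<^sup>+x\<in>ball (fst i) (5 * snd i). t * u x \<partial>lebesgue)
      \<le> (\<integral>\<^sup>+x\<in>ball (fst i) (snd i). g x * u x \<partial>lebesgue)" .
  qed (use r in auto)
  finally show ?thesis .
qed

text \<open>Values of g up to s contribute at most s times the u-mass of the ball, which is at most
  the u-mass of its dilate. This is the endpoint of bounded functions for the interpolation
  below.\<close>

lemma dilated_maximal_truncation:
  fixes F :: "('a::euclidean_space \<times> real) set"
  assumes [measurable]: "u \<in> borel_measurable lebesgue" "g \<in> borel_measurable lebesgue"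
    and r: "\<And>i. i \<in> F \<Longrightarrow> 0 < snd i"
  shows "dilated_maximal F u g x \<le> dilated_maximal F u (\<lambda>y. if s < g y then g y else 0) x + s"
  unfolding dilated_maximal_def
proof (rule SUP_least)
  fix i assume i: "i \<in> {i \<in> F. x \<in> ball (fst i) (snd i)}"
  let ?B = "ball (fst i) (snd i)" and ?g = "\<lambda>y. if s < g y then g y else 0"
  let ?d = "\<integral>\<^sup>+y\<in>ball (fst i) (5 * snd i). u y \<partial>lebesgue"
  have pos: "0 < snd i"
    using r i by auto
  have "(\<integral>\<^sup>+y\<in>?B. g y * u y \<partial>lebesgue)
    \<le> (\<integral>\<^sup>+y. ?g y * u y * indicator ?B y + s * (u y * indicator (ball (fst i) (5 * snd i)) y) \<partial>lebesgue)"
    using pos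
    by (intro nn_integral_mono) (auto simp: indicator_def intro!: mult_right_mono)
  also have "\<dots> = (\<integral>\<^sup>+y\<in>?B. ?g y * u y \<partial>lebesgue) + s * ?d"
    by (subst nn_integral_add, measurable, subst nn_integral_cmult, measurable)
  finally have "(\<integral>\<^sup>+y\<in>?B. g y * u y \<partial>lebesgue) / ?d
      \<le> ((\<integral>\<^sup>+y\<in>?B. ?g y * u y \<partial>lebesgue) + s * ?d) / ?d"
    by (rule divide_right_mono_ennreal)
  then have le: "(\<integral>\<^sup>+y\<in>?B. g y * u y \<partial>lebesgue) / ?d
      \<le> (\<integral>\<^sup>+y\<in>?B. ?g y * u y \<partial>lebesgue) / ?d + s * ?d / ?d"
    by (simp only: add_divide_distrib_ennreal)
  \<comment> \<open>Only an inequality: if \<open>?d\<close> is 0 or \<open>top\<close>, the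
    quotient is 0.\<close>
  have "s * ?d / ?d \<le> s"
    by (cases "?d = 0 \<or> ?d = top") (auto simp: ennreal_mult_divide_eq)
  moreover have "(\<integral>\<^sup>+y\<in>?B. ?g y * u y \<partial>lebesgue) / ?d
    \<le> (SUP i\<in>{i \<in> F. x \<in> ball (fst i) (snd i)}.
     (\<integral>\<^sup>+y\<in>ball (fst i) (snd i). ?g y * u y \<partial>lebesgue)
       / (\<integral>\<^sup>+y\<in>ball (fst i) (5 * snd i). u y \<partial>lebesgue))"
    using i by (rule SUP_upper)
  ultimately show "(\<integral>\<^sup>+y\<in>?B. g y * u y \<partial>lebesgue) / ?d \<le> (SUP i\<in>{i \<in> F. x \<in> ball (fst i) (snd i)}.
     (\<integral>\<^sup>+y\<in>ball (fst i) (snd i). ?g y * u y \<partial>lebesgue)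
       / (\<integral>\<^sup>+y\<in>ball (fst i) (5 * snd i). u y \<partial>lebesgue)) + s"
    by (intro order_trans[OF le] add_mono)
qed

text \<open>Marcinkiewicz interpolation. Where the maximal function of g exceeds t, that of the part
  of g above t/2 exceeds t/2; the weak bound for this part gives the factor 2/t. Integration against
  q t^(q-1) produces 2 q (2 g)^(q-1) g / (q-1), that is 2^q q g^q / (q-1).\<close>

lemma dilated_maximal_strong_type:
  fixes F :: "('a::euclidean_space \<times> real) set"
  assumes [measurable]: "u \<in> borel_measurable lebesgue" "g \<in> borel_measurable lebesgue"
    and r: "\<And>i. i \<in> F \<Longrightarrow> 0 < snd i \<and> snd i \<le> L"
    and q: "1 < q"
  shows "(\<integral>\<^sup>+x. epowr (dilated_maximal F u g x) q * u x \<partial>lebesgue)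
    \<le> ennreal (2 powr q * q / (q - 1)) * (\<integral>\<^sup>+x. epowr (g x) q * u x \<partial>lebesgue)"
proof -
  interpret leb: sigma_finite_measure "lebesgue :: 'a measure"
    by (rule sigma_finite_lebesgue)
  interpret pair_sigma_finite "lebesgue :: 'a measure" "lborel :: real measure" ..
  let ?M = "dilated_maximal F u g"
  have weak: "(\<integral>\<^sup>+x. (if ennreal t < ?M x then 1 else 0) * u x \<partial>lebesgue)
    \<le> ennreal (2 / t) * (\<integral>\<^sup>+x. (if ennreal t < 2 * g x then 1 else 0) * (g x * u x) \<partial>lebesgue)"
    if t: "0 < t" for t
  proof -
    let ?s = "ennreal (t / 2)"
    let ?g = "\<lambda>y. if ?s < g y then g y else 0"
    have double: "?s + ?s = ennreal t"
      using t by (simp flip: ennreal_plus)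
    have sub: "?s < dilated_maximal F u ?g x" if "ennreal t < ?M x" for x
    proof (rule ccontr)
      assume "\<not> ?s < dilated_maximal F u ?g x"
      then have "dilated_maximal F u ?g x + ?s \<le> ?s + ?s"
        by (intro add_mono) auto
      moreover have "?M x \<le> dilated_maximal F u ?g x + ?s"
        using r by (intro dilated_maximal_truncation) auto
      ultimately have "?M x \<le> ennreal t"
        unfolding double by (rule order_trans[rotated])
      with that show False
        by simp
    qed
    have "?s * (\<integral>\<^sup>+x. (if ennreal t < ?M x then 1 else 0) * u x \<partial>lebesgue)
      \<le> ?s * (\<integral>\<^sup>+x\<in>{x. ?s < dilated_maximal F u ?g x}. u x \<partial>lebesgue)"
      using sub by (intro mult_left_mono nn_integral_mono) auto
    also have "\<dots> \<le> (\<integral>\<^sup>+x. ?g x * u x \<partial>lebesgue)"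
      by (rule dilated_maximal_weak_type[OF _ _ r]) auto
    also have "\<dots> = (\<integral>\<^sup>+x. (if ennreal t < 2 * g x then 1 else 0) * (g x * u x) \<partial>lebesgue)"
    proof (rule nn_integral_cong)
      fix x
      \<comment> \<open>The threshold is rewritten with t alone on one side, as in the layer cake
        formula.\<close>
      have "?s < g x \<longleftrightarrow> ennreal t < 2 * g x"
        using t by (cases "g x")
          (auto simp: ennreal_less_iff ennreal_mult_top numeral_mult_ennreal)
      then show "?g x * u x = (if ennreal t < 2 * g x then 1 else 0) * (g x * u x)"
        by simp
    qed
    finally have "ennreal (2 / t) * (?s * (\<integral>\<^sup>+x. (if ennreal t < ?M x then 1 else 0) * u x \<partial>lebesgue))
      \<le> ennreal (2 / t) * (\<integral>\<^sup>+x. (if ennreal t < 2 * g x then 1 else 0) * (g x * u x) \<partial>lebesgue)"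
      by (rule mult_left_mono) simp
    moreover have "ennreal (2 / t) * ?s = 1"
      using t by (simp flip: ennreal_mult)
    ultimately show ?thesis
      by (simp flip: mult.assoc)
  qed
  let ?c = "\<lambda>t. ennreal (q * t powr (q - 1)) * indicator {0<..} t"
  let ?d = "\<lambda>t. ennreal (2 * q * t powr (q - 2)) * indicator {0<..} t"
  have "(\<integral>\<^sup>+x. epowr (?M x) q * u x \<partial>lebesgue)
    = (\<integral>\<^sup>+x. (\<integral>\<^sup>+t. ?c t * ((if ennreal t < ?M x then 1 else 0) * u x) \<partial>lborel) \<partial>lebesgue)"
  proof (rule nn_integral_cong)
    fix x
    have "epowr (?M x) q = ennreal q * (epowr (?M x) q / ennreal q)"
      using q by (simp add: ennreal_times_divide mult.commute[of "ennreal q"] ennreal_mult_divide_eq)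
    also have "epowr (?M x) q / ennreal q
      = (\<integral>\<^sup>+t\<in>{0<..}. ennreal (t powr (q - 1)) * (if ennreal t < ?M x then 1 else 0) \<partial>lborel)"
      using layer_cake_power[of "q - 1" "?M x"] q by simp
    finally have "epowr (?M x) q * u x = ennreal q *
        (\<integral>\<^sup>+t\<in>{0<..}. ennreal (t powr (q - 1)) * (if ennreal t < ?M x then 1 else 0) \<partial>lborel) * u x"
      by simp
    also have "\<dots> = (\<integral>\<^sup>+t. ennreal q *
        (ennreal (t powr (q - 1)) * (if ennreal t < ?M x then 1 else 0) * indicator {0<..} t) * u x \<partial>lborel)"
      by (subst nn_integral_cmult[symmetric], simp, subst nn_integral_multc[symmetric]) simp_all
    also have "\<dots> = (\<integral>\<^sup>+t. ?c t * ((if ennreal t < ?M x then 1 else 0) * u x) \<partial>lborel)"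
      using q by (intro nn_integral_cong) (simp add: ennreal_mult mult_ac)
    finally show "epowr (?M x) q * u x
      = (\<integral>\<^sup>+t. ?c t * ((if ennreal t < ?M x then 1 else 0) * u x) \<partial>lborel)" .
  qed
  also have "\<dots> = (\<integral>\<^sup>+t. (\<integral>\<^sup>+x. ?c t * ((if ennreal t < ?M x then 1 else 0) * u x) \<partial>lebesgue) \<partial>lborel)"
    by (rule Fubini'[symmetric]) measurable
  also have "\<dots> \<le> (\<integral>\<^sup>+t. (\<integral>\<^sup>+x. ?d t * ((if ennreal t < 2 * g x then 1 else 0) * (g x * u x)) \<partial>lebesgue) \<partial>lborel)"
  proof (rule nn_integral_mono)
    fix t :: real
    show "(\<integral>\<^sup>+x. ?c t * ((if ennreal t < ?M x then 1 else 0) * u x) \<partial>lebesgue)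
      \<le> (\<integral>\<^sup>+x. ?d t * ((if ennreal t < 2 * g x then 1 else 0) * (g x * u x)) \<partial>lebesgue)"
    proof (cases "0 < t")
      case True
      have "q * t powr (q - 1) * (2 / t) = 2 * q * t powr (q - 2)"
        using True powr_diff[of t "q - 1" 1] by simp
      then have cd: "?c t * ennreal (2 / t) = ?d t"
        using True q by (simp flip: ennreal_mult)
      have "(\<integral>\<^sup>+x. ?c t * ((if ennreal t < ?M x then 1 else 0) * u x) \<partial>lebesgue)
        = ?c t * (\<integral>\<^sup>+x. (if ennreal t < ?M x then 1 else 0) * u x \<partial>lebesgue)"
        by (rule nn_integral_cmult) measurable
      also have "\<dots> \<le> ?c t * (ennreal (2 / t) *
          (\<integral>\<^sup>+x. (if ennreal t < 2 * g x then 1 else 0) * (g x * u x) \<partial>lebesgue))"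
        by (intro mult_left_mono weak True) simp
      also have "\<dots> = ?d t * (\<integral>\<^sup>+x. (if ennreal t < 2 * g x then 1 else 0) * (g x * u x) \<partial>lebesgue)"
        by (simp only: cd flip: mult.assoc)
      also have "\<dots> = (\<integral>\<^sup>+x. ?d t * ((if ennreal t < 2 * g x then 1 else 0) * (g x * u x)) \<partial>lebesgue)"
        by (rule nn_integral_cmult[symmetric]) measurable
      finally show ?thesis .
    qed simp
  qed
  also have "\<dots> = (\<integral>\<^sup>+x. (\<integral>\<^sup>+t. ?d t * ((if ennreal t < 2 * g x then 1 else 0) * (g x * u x)) \<partial>lborel) \<partial>lebesgue)"
    by (rule Fubini') measurable
  also have "\<dots> = (\<integral>\<^sup>+x. ennreal (2 powr q * q / (q - 1)) * (epowr (g x) q * u x) \<partial>lebesgue)"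
  proof (rule nn_integral_cong)
    fix x
    have "(\<integral>\<^sup>+t. ?d t * ((if ennreal t < 2 * g x then 1 else 0) * (g x * u x)) \<partial>lborel)
      = (\<integral>\<^sup>+t. ennreal (2 * q) *
        (ennreal (t powr (q - 2)) * (if ennreal t < 2 * g x then 1 else 0) * indicator {0<..} t) * (g x * u x) \<partial>lborel)"
      using q by (intro nn_integral_cong) (simp add: ennreal_mult mult_ac)
    also have "\<dots> = ennreal (2 * q) *
        (\<integral>\<^sup>+t\<in>{0<..}. ennreal (t powr (q - 2)) * (if ennreal t < 2 * g x then 1 else 0) \<partial>lborel) * (g x * u x)"
      by (subst nn_integral_cmult[symmetric], simp, subst nn_integral_multc[symmetric]) simp_all
    also have "\<dots> = ennreal (2 * q) * (epowr (2 * g x) (q - 1) / ennreal (q - 1)) * (g x * u x)"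
      using layer_cake_power[of "q - 2" "2 * g x"] q by simp
    also have "epowr (2 * g x) (q - 1) = ennreal (2 powr (q - 1)) * epowr (g x) (q - 1)"
      using epowr_ennreal[of 2 "q - 1"] by (simp add: epowr_mult)
    also have "ennreal (2 * q) * (ennreal (2 powr (q - 1)) * epowr (g x) (q - 1) / ennreal (q - 1)) * (g x * u x)
      = (ennreal (2 * q) * ennreal (2 powr (q - 1)) * inverse (ennreal (q - 1))) * ((epowr (g x) (q - 1) * epowr (g x) 1) * u x)"
      by (simp add: divide_ennreal_def mult_ac)
    also have "ennreal (2 * q) * ennreal (2 powr (q - 1)) * inverse (ennreal (q - 1))
      = ennreal (2 powr q * q / (q - 1))"
      using q by (simp add: inverse_ennreal powr_diff field_simps flip: ennreal_mult)
    also have "epowr (g x) (q - 1) * epowr (g x) 1 = epowr (g x) q"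
      by (simp only: epowr_add) simp
    finally show "(\<integral>\<^sup>+t. ?d t * ((if ennreal t < 2 * g x then 1 else 0) * (g x * u x)) \<partial>lborel)
      = ennreal (2 powr q * q / (q - 1)) * (epowr (g x) q * u x)" .
  qed
  also have "\<dots> = ennreal (2 powr q * q / (q - 1)) * (\<integral>\<^sup>+x. epowr (g x) q * u x \<partial>lebesgue)"
    by (rule nn_integral_cmult) measurable
  finally show ?thesis .
qed

subsection \<open>Means over balls and local Morrey norms\<close>

lemma epowr_le_epowr_iff: "0 < a \<Longrightarrow> epowr x a \<le> epowr y a \<longleftrightarrow> x \<le> y"
  by (simp add: epowr_le_iff epowr_epowr)

lemma divide_le_iff_of_pos: "0 < a \<Longrightarrow> x / ennreal a \<le> y \<longleftrightarrow> x \<le> y * ennreal a"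
  by (rule divide_le_iff_ennreal) auto

lemma mult_right_le_cancel_ennreal:
  fixes x y m :: ennreal
  assumes "x * m \<le> y * m" "0 < m" "m < top"
  shows "x \<le> y"
  using assms ennreal_mult_le_mult_iff[of m x y] by (simp add: mult.commute less_top)

lemma weight_measurable: "weight w \<Longrightarrow> w \<in> borel_measurable lebesgue"
  by (simp add: weight_def)

text \<open>Indexed by centre and radius, because dilation and the splitting into families of balls
  act on these data.\<close>

definition avg :: "('a::euclidean_space \<Rightarrow> real) \<Rightarrow> 'a \<Rightarrow> real \<Rightarrow> ennreal" where
  "avg f c r = (\<integral>\<^sup>+x\<in>ball c r. ennreal \<bar>f x\<bar> \<partial>lebesgue) / emeasure lebesgue (ball c r)"

lemma maximal_eq_SUP_avg:
  "maximal f x = (SUP i\<in>{i. 0 < snd i \<and> x \<in> ball (fst i) (snd i)}. avg f (fst i) (snd i))"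
proof (rule antisym)
  show "maximal f x \<le> (SUP i\<in>{i. 0 < snd i \<and> x \<in> ball (fst i) (snd i)}. avg f (fst i) (snd i))"
    unfolding maximal_def
  proof (rule SUP_least)
    fix B assume "B \<in> {B. is_ball B \<and> x \<in> B}"
    then obtain c r where "0 < r" "B = ball c r" "x \<in> ball c r"
      by (auto simp: is_ball_def)
    then show "(\<integral>\<^sup>+y\<in>B. ennreal \<bar>f y\<bar> \<partial>lebesgue) / emeasure lebesgue B
      \<le> (SUP i\<in>{i. 0 < snd i \<and> x \<in> ball (fst i) (snd i)}. avg f (fst i) (snd i))"
      by (intro SUP_upper2[of "(c, r)"]) (auto simp: avg_def)
  qed
  show "(SUP i\<in>{i. 0 < snd i \<and> x \<in> ball (fst i) (snd i)}. avg f (fst i) (snd i)) \<le> maximal f x"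
    unfolding maximal_def avg_def
    by (rule SUP_least, rule SUP_upper) (auto simp: is_ball_def)
qed

lemma maximal_measurable [measurable]: "maximal f \<in> borel_measurable lebesgue"
proof -
  have "(\<lambda>x. SUP i\<in>{i \<in> {i. 0 < snd i}. x \<in> ball (fst i) (snd i)}. avg f (fst i) (snd i))
    \<in> borel_measurable borel"
    by (rule measurable_SUP_open) simp
  then have "maximal f \<in> borel_measurable lborel"
    by (simp add: maximal_eq_SUP_avg[abs_def])
  then show ?thesis
    by (rule measurable_completion)
qed

lemma avg_mult_measure:
  "0 < r \<Longrightarrow> avg f c r * emeasure lebesgue (ball c r) = (\<integral>\<^sup>+x\<in>ball c r. ennreal \<bar>f x\<bar> \<partial>lebesgue)"
  using emeasure_lebesgue_ball_pos[of r c] emeasure_lebesgue_ball_finite[of c r]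
  unfolding avg_def
  by (subst ennreal_divide_times, subst ennreal_divide_self) auto

lemma avg_enlarge:
  fixes c d :: "'a::euclidean_space"
  assumes "0 < r" "0 < a" "ball c r \<subseteq> ball d (a * r)"
  shows "avg f c r \<le> ennreal (a ^ DIM('a)) * avg f d (a * r)"
proof -
  have "avg f c r * emeasure lebesgue (ball c r)
    \<le> avg f d (a * r) * emeasure lebesgue (ball d (a * r))"
    unfolding avg_mult_measure[OF assms(1)] avg_mult_measure[OF mult_pos_pos[OF assms(2,1)]]
    using assms(3) by (auto simp: indicator_def intro!: nn_integral_mono)
  also have "\<dots> = ennreal (a ^ DIM('a)) * avg f d (a * r) * emeasure lebesgue (ball c r)"
    using assms by (subst emeasure_lebesgue_ball_scale[where d=c]) (auto simp: mult_ac)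
  finally show ?thesis
    using emeasure_lebesgue_ball_pos[OF assms(1), of c] emeasure_lebesgue_ball_finite[of c r]
    by (rule mult_right_le_cancel_ennreal)
qed

text \<open>Both norms see \<phi> only on balls centred at the origin, so the growth conditions are
  kept in radial form.\<close>

locale radial_growth =
  fixes \<phi> :: "'a::euclidean_space set \<Rightarrow> real" and D Q \<epsilon> :: real
  assumes \<phi>_pos: "0 < R \<Longrightarrow> 0 < \<phi> (ball 0 R)"
    and \<phi>_doubling: "0 < R \<Longrightarrow> \<phi> (ball 0 (2 * R)) \<le> D * \<phi> (ball 0 R)"
    and \<phi>_reverse: "0 < s \<Longrightarrow> s \<le> R \<Longrightarrow> \<phi> (ball 0 s) \<le> Q * (s / R) powr \<epsilon> * \<phi> (ball 0 R)"
    and \<epsilon>_pos: "0 < \<epsilon>"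
begin

lemma D_pos: "0 < D"
proof -
  have "0 < D * \<phi> (ball 0 1)"
    using \<phi>_pos[of 2] \<phi>_doubling[of 1] by simp
  then show ?thesis
    using \<phi>_pos[of 1] by (simp add: zero_less_mult_iff)
qed

lemma Q_pos: "0 < Q"
  using \<phi>_pos[of 1] \<phi>_reverse[of 1 1] by simp

lemma \<phi>_mono: "0 < s \<Longrightarrow> s \<le> R \<Longrightarrow> \<phi> (ball 0 s) \<le> Q * \<phi> (ball 0 R)"
proof -
  assume s: "0 < s" "s \<le> R"
  have "(s / R) powr \<epsilon> \<le> 1"
    using s \<epsilon>_pos by (intro powr_le1) auto
  then have "Q * (s / R) powr \<epsilon> * \<phi> (ball 0 R) \<le> Q * 1 * \<phi> (ball 0 R)"
    using s Q_pos \<phi>_pos[of R] by (intro mult_right_mono mult_left_mono) auto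
  with \<phi>_reverse[OF s] show ?thesis
    by simp
qed

text \<open>Supremum, quotient and root disappear. Norm bounds below are proved in this form, which
  is valid for c = \<open>top\<close> too.\<close>

lemma LM_norm_le_iff:
  assumes "0 < p"
  shows "LM_norm p \<phi> w g \<le> c \<longleftrightarrow> (\<forall>R>0.
    (\<integral>\<^sup>+x\<in>ball 0 R. epowr (g x) p * ennreal (w x) \<partial>lebesgue) \<le> epowr c p * ennreal (\<phi> (ball 0 R)))"
  using assms by (auto simp: LM_norm_def SUP_le_iff epowr_le_iff divide_le_iff_of_pos \<phi>_pos)

lemma WLM_norm_le_iff:
  assumes "0 < p"
  shows "WLM_norm p \<phi> w g \<le> c \<longleftrightarrow> (\<forall>R>0. \<forall>t>0.
    epowr (ennreal t) p * (\<integral>\<^sup>+x\<in>{x \<in> ball 0 R. g x > ennreal t}. ennreal (w x) \<partial>lebesgue)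
      \<le> epowr c p * ennreal (\<phi> (ball 0 R)))"
proof -
  have "ennreal t * epowr (X / ennreal (\<phi> (ball 0 R))) (1 / p) \<le> c
    \<longleftrightarrow> epowr (ennreal t) p * X \<le> epowr c p * ennreal (\<phi> (ball 0 R))" if "0 < R" for t R X
  proof -
    have "ennreal t * epowr (X / ennreal (\<phi> (ball 0 R))) (1 / p) \<le> c
      \<longleftrightarrow> epowr (ennreal t * epowr (X / ennreal (\<phi> (ball 0 R))) (1 / p)) p \<le> epowr c p"
      using assms by (simp add: epowr_le_epowr_iff)
    also have "\<dots> \<longleftrightarrow> epowr (ennreal t) p * X / ennreal (\<phi> (ball 0 R)) \<le> epowr c p"
      using assms by (simp add: epowr_mult epowr_epowr ennreal_times_divide)
    finally show ?thesis
      using that \<phi>_pos by (simp add: divide_le_iff_of_pos)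
  qed
  then show ?thesis
    by (simp add: WLM_norm_def SUP_le_iff Ball_def)
qed

lemma nn_integral_le_LM_norm:
  assumes "0 < p" "0 < R"
  shows "(\<integral>\<^sup>+x\<in>ball 0 R. epowr (g x) p * ennreal (w x) \<partial>lebesgue)
    \<le> epowr (LM_norm p \<phi> w g) p * ennreal (\<phi> (ball 0 R))"
  using LM_norm_le_iff[OF assms(1), of w g "LM_norm p \<phi> w g"] assms(2) by simp

lemma LM_norm_mono:
  assumes "0 < p" "\<And>x. g x \<le> h x"
  shows "LM_norm p \<phi> w g \<le> LM_norm p \<phi> w h"
proof (subst LM_norm_le_iff[OF assms(1)], intro allI impI)
  fix R :: real assume R: "0 < R"
  have "(\<integral>\<^sup>+x\<in>ball 0 R. epowr (g x) p * ennreal (w x) \<partial>lebesgue)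
    \<le> (\<integral>\<^sup>+x\<in>ball 0 R. epowr (h x) p * ennreal (w x) \<partial>lebesgue)"
    using assms by (intro nn_integral_mono mult_right_mono epowr_mono) auto
  also have "\<dots> \<le> epowr (LM_norm p \<phi> w h) p * ennreal (\<phi> (ball 0 R))"
    by (rule nn_integral_le_LM_norm[OF assms(1) R])
  finally show "(\<integral>\<^sup>+x\<in>ball 0 R. epowr (g x) p * ennreal (w x) \<partial>lebesgue)
    \<le> epowr (LM_norm p \<phi> w h) p * ennreal (\<phi> (ball 0 R))" .
qed

lemma LM_norm_cmult_le:
  assumes "0 < p" and [measurable]: "g \<in> borel_measurable lebesgue" "w \<in> borel_measurable lebesgue"
  shows "LM_norm p \<phi> w (\<lambda>x. a * g x) \<le> a * LM_norm p \<phi> w g"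
proof (subst LM_norm_le_iff[OF assms(1)], intro allI impI)
  fix R :: real assume R: "0 < R"
  have "(\<integral>\<^sup>+x\<in>ball 0 R. epowr (a * g x) p * ennreal (w x) \<partial>lebesgue)
    = epowr a p * (\<integral>\<^sup>+x\<in>ball 0 R. epowr (g x) p * ennreal (w x) \<partial>lebesgue)"
    unfolding epowr_mult mult.assoc by (rule nn_integral_cmult) measurable
  also have "\<dots> \<le> epowr a p * (epowr (LM_norm p \<phi> w g) p * ennreal (\<phi> (ball 0 R)))"
    by (intro mult_left_mono nn_integral_le_LM_norm assms(1) R) simp
  finally show "(\<integral>\<^sup>+x\<in>ball 0 R. epowr (a * g x) p * ennreal (w x) \<partial>lebesgue)
    \<le> epowr (a * LM_norm p \<phi> w g) p * ennreal (\<phi> (ball 0 R))"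
    by (simp add: epowr_mult mult.assoc)
qed

section \<open>The A-condition applied to functions\<close>

lemma A_const_ball_unit:
  assumes "f \<in> borel_measurable lebesgue" "LM_norm p \<phi> w (absf f) \<le> 1" "0 < r"
  shows "(\<integral>\<^sup>+x\<in>ball c r. ennreal \<bar>f x\<bar> \<partial>lebesgue) * LM_norm p \<phi> w (absf (indicator (ball c r)))
    \<le> A_const p \<phi> w * emeasure lebesgue (ball c r)"
proof -
  let ?B = "ball c r"
  have "(\<integral>\<^sup>+x\<in>?B. ennreal \<bar>f x\<bar> \<partial>lebesgue) = (\<integral>\<^sup>+x. ennreal \<bar>f x * indicator ?B x\<bar> \<partial>lebesgue)"
    by (intro nn_integral_cong) (auto simp: indicator_def)
  also have "\<dots> \<le> LM_dual_norm p \<phi> w (indicator ?B)"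
    unfolding LM_dual_norm_def using assms by (intro SUP_upper) auto
  finally have "LM_norm p \<phi> w (absf (indicator ?B)) * (\<integral>\<^sup>+x\<in>?B. ennreal \<bar>f x\<bar> \<partial>lebesgue)
    \<le> LM_norm p \<phi> w (absf (indicator ?B)) * LM_dual_norm p \<phi> w (indicator ?B)"
    by (rule mult_left_mono) simp
  also have "\<dots> \<le> A_const p \<phi> w * emeasure lebesgue ?B"
  proof (subst divide_le_iff_ennreal[symmetric])
    show "LM_norm p \<phi> w (absf (indicator ?B)) * LM_dual_norm p \<phi> w (indicator ?B)
        / emeasure lebesgue ?B \<le> A_const p \<phi> w"
      unfolding A_const_def using assms(3) by (intro SUP_upper) (auto simp: is_ball_def)
  qed (use assms(3) emeasure_lebesgue_ball_pos emeasure_lebesgue_ball_finite in auto)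
  finally show ?thesis
    by (simp add: mult.commute)
qed

text \<open>The unit ball is reached by scaling. Since the norm n of f may be 0, f is divided by an
  arbitrary l > n, and l then tends to n.\<close>

lemma A_const_ball:
  assumes p: "0 < p" and [measurable]: "w \<in> borel_measurable lebesgue" "f \<in> borel_measurable lebesgue"
    and K: "A_const p \<phi> w < top" and f: "LM_norm p \<phi> w (absf f) < top" and r: "0 < r"
  shows "(\<integral>\<^sup>+x\<in>ball c r. ennreal \<bar>f x\<bar> \<partial>lebesgue) * LM_norm p \<phi> w (absf (indicator (ball c r)))
    \<le> A_const p \<phi> w * emeasure lebesgue (ball c r) * LM_norm p \<phi> w (absf f)"
proof -
  let ?X = "(\<integral>\<^sup>+x\<in>ball c r. ennreal \<bar>f x\<bar> \<partial>lebesgue) * LM_norm p \<phi> w (absf (indicator (ball c r)))"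
  let ?Y = "A_const p \<phi> w * emeasure lebesgue (ball c r)"
  have "?Y < top"
    using K emeasure_lebesgue_ball_finite[of c r] by (simp add: ennreal_mult_less_top)
  then obtain y where y: "?Y = ennreal y" "0 \<le> y"
    by (cases ?Y) auto
  obtain n where n: "LM_norm p \<phi> w (absf f) = ennreal n" "0 \<le> n"
    using f by (cases "LM_norm p \<phi> w (absf f)") auto
  have le: "?X \<le> ennreal (l * y)" if l: "n < l" for l
  proof -
    have l0: "0 < l"
      using l n by simp
    let ?h = "\<lambda>x. f x / l"
    have eq: "absf ?h = (\<lambda>x. ennreal (1 / l) * absf f x)"
      using l0 by (auto simp: ennreal_mult[symmetric])
    have "LM_norm p \<phi> w (absf ?h) \<le> ennreal (1 / l) * ennreal n"
      unfolding eq n(1)[symmetric] by (rule LM_norm_cmult_le[OF p]) measurable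
    also have "\<dots> \<le> 1"
      using l l0 n by (simp add: ennreal_mult[symmetric])
    finally have "LM_norm p \<phi> w (absf ?h) \<le> 1" .
    then have "(\<integral>\<^sup>+x\<in>ball c r. ennreal \<bar>?h x\<bar> \<partial>lebesgue) * LM_norm p \<phi> w (absf (indicator (ball c r))) \<le> ?Y"
      by (intro A_const_ball_unit r) measurable
    then have "ennreal l * ((\<integral>\<^sup>+x\<in>ball c r. ennreal \<bar>?h x\<bar> \<partial>lebesgue) * LM_norm p \<phi> w (absf (indicator (ball c r))))
      \<le> ennreal l * ennreal y"
      unfolding y(1)[symmetric] by (rule mult_left_mono) simp
    moreover have "ennreal l * (\<integral>\<^sup>+x\<in>ball c r. ennreal \<bar>?h x\<bar> \<partial>lebesgue)
      = (\<integral>\<^sup>+x\<in>ball c r. ennreal \<bar>f x\<bar> \<partial>lebesgue)"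
      using l0 by (subst nn_integral_cmult[symmetric]) (auto simp: ennreal_mult[symmetric] mult.assoc[symmetric])
    ultimately show ?thesis
      using l0 y by (simp add: mult.assoc[symmetric] ennreal_mult)
  qed
  have "?X \<le> ennreal (y * n)"
  proof (rule ennreal_le_epsilon)
    fix e :: real assume e: "0 < e"
    \<comment> \<open>The increment times y is at most e; the 1 guards against y = 0.\<close>
    have "?X \<le> ennreal ((n + e / (y + 1)) * y)"
      using e y by (intro le) auto
    also have "\<dots> \<le> ennreal (y * n + e)"
      using e y by (intro ennreal_leI) (simp add: field_simps)
    also have "\<dots> = ennreal (y * n) + ennreal e"
      using e y n by (intro ennreal_plus) auto
    finally show "?X \<le> ennreal (y * n) + ennreal e" .
  qed
  then show ?thesis
    using y n by (simp add: ennreal_mult)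
qed

lemma avg_LM_norm_le:
  assumes "0 < p" "w \<in> borel_measurable lebesgue" "f \<in> borel_measurable lebesgue"
    and "A_const p \<phi> w < top" "LM_norm p \<phi> w (absf f) < top" "0 < r"
  shows "avg f c r * LM_norm p \<phi> w (absf (indicator (ball c r)))
    \<le> A_const p \<phi> w * LM_norm p \<phi> w (absf f)"
proof -
  let ?m = "emeasure lebesgue (ball c r)"
  have m: "0 < ?m" "?m < top"
    using assms emeasure_lebesgue_ball_pos emeasure_lebesgue_ball_finite by auto
  have "avg f c r * LM_norm p \<phi> w (absf (indicator (ball c r)))
    = ((\<integral>\<^sup>+x\<in>ball c r. ennreal \<bar>f x\<bar> \<partial>lebesgue) * LM_norm p \<phi> w (absf (indicator (ball c r)))) / ?m"
    by (simp add: avg_def divide_ennreal_def mult_ac)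
  also have "\<dots> \<le> A_const p \<phi> w * LM_norm p \<phi> w (absf f)"
    unfolding divide_le_iff_ennreal[OF m]
    using A_const_ball[OF assms, of c] by (simp add: mult_ac)
  finally show ?thesis .
qed

lemma measure_ball_inter_le:
  assumes "0 < p" "0 < R"
  shows "(\<integral>\<^sup>+x\<in>B \<inter> ball 0 R. ennreal (w x) \<partial>lebesgue)
    \<le> epowr (LM_norm p \<phi> w (absf (indicator B))) p * ennreal (\<phi> (ball 0 R))"
proof -
  have "(\<integral>\<^sup>+x\<in>B \<inter> ball 0 R. ennreal (w x) \<partial>lebesgue)
    = (\<integral>\<^sup>+x\<in>ball 0 R. epowr (absf (indicator B) x) p * ennreal (w x) \<partial>lebesgue)"
    by (intro nn_integral_cong) (auto simp: indicator_def)
  then show ?thesis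
    using nn_integral_le_LM_norm[OF assms, of "absf (indicator B)" w] by simp
qed

end

subsection \<open>Weak type estimates\<close>

text \<open>It depends on |x| alone and does not increase with it, since x enters only through s >
  |x|.\<close>

definition central_maximal :: "('a::euclidean_space \<Rightarrow> real) \<Rightarrow> 'a \<Rightarrow> ennreal" where
  "central_maximal f x = (SUP s\<in>{s \<in> {0<..}. x \<in> ball 0 s}. avg f 0 s)"

lemma central_maximal_measurable [measurable]: "central_maximal f \<in> borel_measurable lebesgue"
  unfolding central_maximal_def
  by (rule measurable_completion, unfold measurable_lborel2, rule measurable_SUP_open) simp

section \<open>Weak bounds on the two families of balls\<close>

context radial_growth
begin

text \<open>With s = |c|/2 the ball lies in B(0, 4 s) and misses B(0, s). The cut-off of f therefore
  has norm at most (Q I / \<phi>(B(0, s)))^(1/p), I being the integral on the right, while the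
  w-mass of the ball is at most \<phi>(B(0, 4 s)) times the p-th power of the norm of its
  characteristic function. The values of \<phi> cancel up to two doublings. Keeping f in the
  condition allows p = 1 and lets the ball be larger than the support of f.\<close>

lemma local_Ap:
  fixes c :: 'a
  assumes p: "0 < p" and [measurable]: "w \<in> borel_measurable lebesgue" "f \<in> borel_measurable lebesgue"
    and K: "A_const p \<phi> w < top" and r: "0 < r" "2 * r < norm c"
    and fin: "(\<integral>\<^sup>+x\<in>ball c r. epowr (absf f x) p * ennreal (w x) \<partial>lebesgue) < top"
  shows "epowr (\<integral>\<^sup>+x\<in>ball c r. ennreal \<bar>f x\<bar> \<partial>lebesgue) p * (\<integral>\<^sup>+x\<in>ball c r. ennreal (w x) \<partial>lebesgue)
    \<le> ennreal (Q * D\<^sup>2) * epowr (A_const p \<phi> w) p * epowr (emeasure lebesgue (ball c r)) p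
      * (\<integral>\<^sup>+x\<in>ball c r. epowr (absf f x) p * ennreal (w x) \<partial>lebesgue)"
proof -
  let ?B = "ball c r"
  let ?I = "\<integral>\<^sup>+x\<in>?B. epowr (absf f x) p * ennreal (w x) \<partial>lebesgue"
  let ?A = "\<integral>\<^sup>+x\<in>?B. ennreal \<bar>f x\<bar> \<partial>lebesgue"
  let ?h = "\<lambda>x. f x * indicator ?B x"
  let ?n = "LM_norm p \<phi> w (absf (indicator ?B))"
  define s where "s = norm c / 2"
  define m where "m = emeasure lebesgue ?B"
  define K' where "K' = A_const p \<phi> w"
  have s: "0 < s"
    using r by (auto simp: s_def)
  define N where "N = epowr (ennreal Q * ?I / ennreal (\<phi> (ball 0 s))) (1 / p)"
  have Np: "epowr N p = ennreal Q * ?I / ennreal (\<phi> (ball 0 s))"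
    using p by (simp add: N_def epowr_epowr)
  have hN: "LM_norm p \<phi> w (absf ?h) \<le> N"
    unfolding LM_norm_le_iff[OF p] Np
  proof (intro allI impI)
    fix R :: real assume R: "0 < R"
    show "(\<integral>\<^sup>+x\<in>ball 0 R. epowr (absf ?h x) p * ennreal (w x) \<partial>lebesgue)
      \<le> ennreal Q * ?I / ennreal (\<phi> (ball 0 s)) * ennreal (\<phi> (ball 0 R))"
    proof (cases "R \<le> s")
      case True
      have disj: "x \<notin> ?B" if "x \<in> ball 0 R" for x
      proof
        assume "x \<in> ?B"
        then have "norm (c - x) < r" "norm x < s"
          using that True by (auto simp: dist_norm)
        then show False
          using norm_triangle_ineq[of "c - x" x] r by (simp add: s_def)
      qed
      have "(\<integral>\<^sup>+x\<in>ball 0 R. epowr (absf ?h x) p * ennreal (w x) \<partial>lebesgue) = (\<integral>\<^sup>+(x::'a). 0 \<partial>lebesgue)"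
        by (intro nn_integral_cong) (use disj in \<open>auto simp: indicator_def\<close>)
      then show ?thesis
        by simp
    next
      case False
      have "(\<integral>\<^sup>+x\<in>ball 0 R. epowr (absf ?h x) p * ennreal (w x) \<partial>lebesgue) \<le> ?I"
        by (intro nn_integral_mono) (auto simp: indicator_def)
      also have "\<dots> = ?I / ennreal (\<phi> (ball 0 s)) * ennreal (\<phi> (ball 0 s))"
        using \<phi>_pos[OF s] by (simp add: ennreal_divide_times)
      also have "\<dots> \<le> ?I / ennreal (\<phi> (ball 0 s)) * ennreal (Q * \<phi> (ball 0 R))"
        using \<phi>_mono[of s R] s False by (intro mult_left_mono ennreal_leI) auto
      also have "\<dots> = ennreal Q * ?I / ennreal (\<phi> (ball 0 s)) * ennreal (\<phi> (ball 0 R))"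
        using Q_pos \<phi>_pos[OF R] by (simp add: ennreal_mult divide_ennreal_def mult_ac)
      finally show ?thesis .
    qed
  qed
  \<comment> \<open>\<open>A_const_ball\<close> speaks of functions of finite norm; this is the
    purpose of \<open>fin\<close>.\<close>
  have "ennreal Q * ?I / ennreal (\<phi> (ball 0 s)) \<noteq> top"
    using fin \<phi>_pos[OF s] by (auto simp: ennreal_divide_eq_top_iff ennreal_mult_eq_top_iff less_top)
  then have "N < top"
    by (auto simp: N_def less_top[symmetric])
  then have "LM_norm p \<phi> w (absf ?h) < top"
    using hN by (rule order_le_less_trans[rotated])
  then have "(\<integral>\<^sup>+x\<in>?B. ennreal \<bar>?h x\<bar> \<partial>lebesgue) * ?n \<le> K' * m * LM_norm p \<phi> w (absf ?h)"
    unfolding K'_def m_def using K r by (intro A_const_ball p) auto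
  also have "(\<integral>\<^sup>+x\<in>?B. ennreal \<bar>?h x\<bar> \<partial>lebesgue) = ?A"
    by (intro nn_integral_cong) (auto simp: indicator_def)
  also have "K' * m * LM_norm p \<phi> w (absf ?h) \<le> K' * m * N"
    using hN by (intro mult_left_mono) auto
  finally have "epowr (?A * ?n) p \<le> epowr (K' * m * N) p"
    using p by (intro epowr_mono) auto
  then have main: "epowr ?A p * epowr ?n p \<le> epowr K' p * epowr m p * epowr N p"
    by (simp add: epowr_mult)
  have "?B \<subseteq> ball 0 (4 * s)"
  proof
    fix x assume "x \<in> ?B"
    then have "norm (x - c) < r"
      by (auto simp: dist_norm norm_minus_commute)
    then show "x \<in> ball 0 (4 * s)"
      using norm_triangle_ineq[of "x - c" c] r by (simp add: s_def)
  qed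
  then have "(\<integral>\<^sup>+x\<in>?B. ennreal (w x) \<partial>lebesgue) \<le> epowr ?n p * ennreal (\<phi> (ball 0 (4 * s)))"
    using measure_ball_inter_le[OF p, of "4 * s" w ?B] s by (simp add: Int_absorb2)
  also have "\<dots> \<le> epowr ?n p * ennreal (D\<^sup>2 * \<phi> (ball 0 s))"
  proof -
    have "\<phi> (ball 0 (4 * s)) \<le> D * \<phi> (ball 0 (2 * s))"
      using \<phi>_doubling[of "2 * s"] s by simp
    also have "\<dots> \<le> D * (D * \<phi> (ball 0 s))"
      using \<phi>_doubling[of s] s D_pos by (intro mult_left_mono) auto
    finally show ?thesis
      by (intro mult_left_mono ennreal_leI) (auto simp: power2_eq_square mult.assoc)
  qed
  finally have "epowr ?A p * (\<integral>\<^sup>+x\<in>?B. ennreal (w x) \<partial>lebesgue)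
    \<le> epowr ?A p * (epowr ?n p * ennreal (D\<^sup>2 * \<phi> (ball 0 s)))"
    by (rule mult_left_mono) simp
  also have "\<dots> \<le> epowr K' p * epowr m p * epowr N p * ennreal (D\<^sup>2 * \<phi> (ball 0 s))"
    unfolding mult.assoc[of "epowr ?A p", symmetric] by (rule mult_right_mono[OF main]) simp
  also have "\<dots> = ennreal (Q * D\<^sup>2) * epowr K' p * epowr m p
      * (?I / ennreal (\<phi> (ball 0 s)) * ennreal (\<phi> (ball 0 s)))"
    using Q_pos D_pos \<phi>_pos[OF s] by (simp add: Np ennreal_mult divide_ennreal_def mult_ac)
  also have "?I / ennreal (\<phi> (ball 0 s)) * ennreal (\<phi> (ball 0 s)) = ?I"
    using \<phi>_pos[OF s] by (simp add: ennreal_divide_times)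
  finally show ?thesis
    by (simp add: K'_def m_def)
qed

text \<open>The factor 16 keeps the fivefold ball within the reach of \<open>local_Ap\<close>, which
  asks for 10 r < |c|. A ball with 16 r < |c| that meets B(0, R) has |c| < R + |c|/16, hence |c| < 3
  R / 2. Both bounds together place it in B(0, 2 R), since 17/16 times 3/2 is below 2, and keep the
  radii below R, as the Vitali lemma requires.\<close>

definition local_balls :: "real \<Rightarrow> ('a \<times> real) set" where
  "local_balls R = {i. 0 < snd i \<and> 16 * snd i < norm (fst i) \<and> 2 * norm (fst i) < 3 * R}"

lemma local_balls_subset: "i \<in> local_balls R \<Longrightarrow> ball (fst i) (snd i) \<subseteq> ball 0 (2 * R)"
proof
  fix x assume i: "i \<in> local_balls R" and "x \<in> ball (fst i) (snd i)"
  then have "norm (x - fst i) < snd i"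
    by (auto simp: dist_norm norm_minus_commute)
  then show "x \<in> ball 0 (2 * R)"
    using i norm_triangle_ineq[of "x - fst i" "fst i"] by (auto simp: local_balls_def)
qed

lemma local_balls_radius: "i \<in> local_balls R \<Longrightarrow> 0 < snd i \<and> snd i \<le> R"
  by (auto simp: local_balls_def)

text \<open>In the constant, Q D^2 comes from \<open>local_Ap\<close> on the fivefold ball, the
  third D from passing from B(0, 2 R), which contains all local balls, to B(0, R), and the power of
  5 from the Lebesgue measure of the dilate.\<close>

lemma weak_local:
  assumes p: "0 < p" and [measurable]: "w \<in> borel_measurable lebesgue" "f \<in> borel_measurable lebesgue"
    and K: "A_const p \<phi> w < top" and f: "LM_norm p \<phi> w (absf f) < top" and R: "0 < R"
  shows "epowr t p * (\<integral>\<^sup>+x\<in>(\<Union>i\<in>{i \<in> local_balls R. t < avg f (fst i) (snd i)}. ball (fst i) (snd i)).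
        ennreal (w x) \<partial>lebesgue)
    \<le> ennreal (Q * D ^ 3) * epowr (ennreal (5 ^ DIM('a))) p
      * epowr (A_const p \<phi> w * LM_norm p \<phi> w (absf f)) p * ennreal (\<phi> (ball 0 R))"
proof -
  define U where "U = (\<Union>i\<in>{i \<in> local_balls R. t < avg f (fst i) (snd i)}. ball (fst i) (snd i))"
  define C where "C = ennreal (Q * D\<^sup>2) * epowr (A_const p \<phi> w) p * epowr (ennreal (5 ^ DIM('a))) p"
  have "open U"
    by (auto simp: U_def)
  then have [measurable]: "U \<in> sets lebesgue"
    by simp
  have fin: "(\<integral>\<^sup>+x\<in>ball 0 (2 * R). epowr (absf f x) p * ennreal (w x) \<partial>lebesgue)
    \<le> epowr (LM_norm p \<phi> w (absf f)) p * ennreal (\<phi> (ball 0 (2 * R)))"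
    using R by (intro nn_integral_le_LM_norm p) auto
  have fin': "epowr (LM_norm p \<phi> w (absf f)) p * ennreal (\<phi> (ball 0 (2 * R))) < top"
    using f by (auto simp: less_top[symmetric] ennreal_mult_eq_top_iff)
  have "epowr t p * (\<integral>\<^sup>+x\<in>U. ennreal (w x) \<partial>lebesgue) = (\<integral>\<^sup>+x\<in>U. epowr t p * ennreal (w x) \<partial>lebesgue)"
    unfolding mult.assoc by (rule nn_integral_cmult[symmetric]) measurable
  also have "\<dots> \<le> (\<integral>\<^sup>+x. C * (epowr (absf f x) p * ennreal (w x) * indicator (ball 0 (2 * R)) x) \<partial>lebesgue)"
    unfolding U_def
  proof (rule Vitali_nn_integral_le)
    fix i assume i: "i \<in> {i \<in> local_balls R. t < avg f (fst i) (snd i)}"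
    define c r where "c = fst i" and "r = snd i"
    have cr: "0 < r" "16 * r < norm c" "t < avg f c r" "ball c r \<subseteq> ball 0 (2 * R)"
      using i local_balls_subset[of i R] by (auto simp: c_def r_def local_balls_def)
    let ?B = "ball c r" and ?B5 = "ball c (5 * r)"
    let ?h = "\<lambda>x. f x * indicator ?B x"
    define m where "m = epowr (emeasure lebesgue ?B) p"
    let ?W = "\<integral>\<^sup>+x\<in>?B5. ennreal (w x) \<partial>lebesgue"
    let ?I = "\<integral>\<^sup>+x\<in>?B. epowr (absf f x) p * ennreal (w x) \<partial>lebesgue"
    have sub: "?B \<subseteq> ?B5"
      using cr by (intro subset_ball) auto
    have hI: "(\<integral>\<^sup>+x\<in>?B5. epowr (absf ?h x) p * ennreal (w x) \<partial>lebesgue) = ?I"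
      using sub by (intro nn_integral_cong) (auto simp: indicator_def)
    have "?I \<le> (\<integral>\<^sup>+x\<in>ball 0 (2 * R). epowr (absf f x) p * ennreal (w x) \<partial>lebesgue)"
      using cr(4) by (intro nn_integral_mono) (auto simp: indicator_def)
    then have Ifin: "?I < top"
      using fin fin' by (meson order_le_less_trans)
    \<comment> \<open>The factor \<open>m\<close>, the p-th power of |B|, turns the bound on the
      mean into one on the integral; it is cancelled at the end.\<close>
    have "epowr t p * m * ?W \<le> epowr (\<integral>\<^sup>+x\<in>?B5. ennreal \<bar>?h x\<bar> \<partial>lebesgue) p * ?W"
    proof (rule mult_right_mono)
      have "t * emeasure lebesgue ?B \<le> avg f c r * emeasure lebesgue ?B"
        using cr(3) by (intro mult_right_mono) auto
      also have "\<dots> = (\<integral>\<^sup>+x\<in>?B. ennreal \<bar>f x\<bar> \<partial>lebesgue)"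
        by (rule avg_mult_measure[OF cr(1)])
      also have "\<dots> = (\<integral>\<^sup>+x\<in>?B5. ennreal \<bar>?h x\<bar> \<partial>lebesgue)"
        using sub by (intro nn_integral_cong) (auto simp: indicator_def)
      finally have "epowr (t * emeasure lebesgue ?B) p \<le> epowr (\<integral>\<^sup>+x\<in>?B5. ennreal \<bar>?h x\<bar> \<partial>lebesgue) p"
        using p by (intro epowr_mono) auto
      then show "epowr t p * m \<le> epowr (\<integral>\<^sup>+x\<in>?B5. ennreal \<bar>?h x\<bar> \<partial>lebesgue) p"
        by (simp only: m_def epowr_mult)
    qed simp
    also have "\<dots> \<le> ennreal (Q * D\<^sup>2) * epowr (A_const p \<phi> w) p * epowr (emeasure lebesgue ?B5) p * ?I"
      unfolding hI[symmetric] using cr K Ifin hI by (intro local_Ap p) auto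
    also have "emeasure lebesgue ?B5 = ennreal (5 ^ DIM('a)) * emeasure lebesgue ?B"
      using cr by (intro emeasure_lebesgue_ball_scale) auto
    also have "ennreal (Q * D\<^sup>2) * epowr (A_const p \<phi> w) p * epowr (ennreal (5 ^ DIM('a)) * emeasure lebesgue ?B) p * ?I
      = C * ?I * m"
      by (simp only: C_def m_def epowr_mult mult_ac)
    finally have "epowr t p * ?W * m \<le> C * ?I * m"
      by (simp only: mult_ac)
    moreover have "0 < m" "m < top"
      using emeasure_lebesgue_ball_pos[OF cr(1), of c] emeasure_lebesgue_ball_finite[of c r]
      unfolding m_def zero_less_iff_neq_zero less_top[symmetric] by (simp_all only: epowr_eq_0_iff epowr_eq_top_iff not_False_eq_True)
    ultimately have le: "epowr t p * ?W \<le> C * ?I"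
      by (rule mult_right_le_cancel_ennreal)
    have "(\<integral>\<^sup>+x\<in>?B5. epowr t p * ennreal (w x) \<partial>lebesgue) = epowr t p * ?W"
      unfolding mult.assoc by (rule nn_integral_cmult) measurable
    also have "\<dots> \<le> C * ?I"
      by (rule le)
    also have "\<dots> = (\<integral>\<^sup>+x. C * (epowr (absf f x) p * ennreal (w x) * indicator ?B x) \<partial>lebesgue)"
      by (rule nn_integral_cmult[symmetric]) measurable
    also have "\<dots> = (\<integral>\<^sup>+x\<in>?B. C * (epowr (absf f x) p * ennreal (w x) * indicator (ball 0 (2 * R)) x) \<partial>lebesgue)"
      using cr(4) by (intro nn_integral_cong) (auto simp: indicator_def)
    finally show "(\<integral>\<^sup>+x\<in>ball (fst i) (5 * snd i). epowr t p * ennreal (w x) \<partial>lebesgue)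
      \<le> (\<integral>\<^sup>+x\<in>ball (fst i) (snd i). C * (epowr (absf f x) p * ennreal (w x) * indicator (ball 0 (2 * R)) x) \<partial>lebesgue)"
      by (simp only: c_def r_def)
  next
    fix i assume "i \<in> {i \<in> local_balls R. t < avg f (fst i) (snd i)}"
    then show "0 < snd i \<and> snd i \<le> R"
      using local_balls_radius[of i R] by simp
  qed measurable
  also have "\<dots> = C * (\<integral>\<^sup>+x\<in>ball 0 (2 * R). epowr (absf f x) p * ennreal (w x) \<partial>lebesgue)"
    by (rule nn_integral_cmult) measurable
  also have "\<dots> \<le> C * (epowr (LM_norm p \<phi> w (absf f)) p * ennreal (\<phi> (ball 0 (2 * R))))"
    by (intro mult_left_mono fin) simp
  also have "\<dots> \<le> C * (epowr (LM_norm p \<phi> w (absf f)) p * ennreal (D * \<phi> (ball 0 R)))"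
    using \<phi>_doubling[OF R] by (intro mult_left_mono ennreal_leI) auto
  also have "\<dots> = (ennreal (Q * D\<^sup>2) * ennreal D) * epowr (ennreal (5 ^ DIM('a))) p
      * epowr (A_const p \<phi> w * LM_norm p \<phi> w (absf f)) p * ennreal (\<phi> (ball 0 R))"
    using D_pos \<phi>_pos[OF R] by (simp only: C_def epowr_mult ennreal_mult less_imp_le mult_ac)
  also have "ennreal (Q * D\<^sup>2) * ennreal D = ennreal (Q * D ^ 3)"
    using D_pos Q_pos by (simp flip: ennreal_mult add: power3_eq_cube power2_eq_square mult_ac)
  finally show ?thesis
    unfolding U_def .
qed

text \<open>Balls centred at the origin are nested, so one ball does the work of a covering: the
  A-condition is used on a single B(0, 2 s) containing E, and replacing the mean over B(0, s) by
  that over B(0, 2 s) costs 2^n.\<close>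

lemma weak_central:
  assumes p: "0 < p" and meas: "w \<in> borel_measurable lebesgue" "f \<in> borel_measurable lebesgue"
    and K: "A_const p \<phi> w < top" and f: "LM_norm p \<phi> w (absf f) < top" and R: "0 < R"
    and E: "E \<subseteq> {x \<in> ball 0 R. t < central_maximal f x}"
  shows "epowr t p * (\<integral>\<^sup>+x\<in>E. ennreal (w x) \<partial>lebesgue)
    \<le> epowr (ennreal (2 ^ DIM('a)) * (A_const p \<phi> w * LM_norm p \<phi> w (absf f))) p * ennreal (\<phi> (ball 0 R))"
proof -
  define S where "S = {s. 0 < s \<and> t < avg f 0 s}"
  have ES: "\<exists>s\<in>S. norm x < s" if "x \<in> E" for x
    using that E by (auto simp: central_maximal_def less_SUP_iff S_def)
  \<comment> \<open>\<open>E\<close> lies in some \<open>ball 0 (2 * s)\<close> with \<open>s \<in> S\<close>: take \<open>s \<ge> R\<close> if possible, otherwise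
    \<open>s > Sup S / 2\<close>.\<close>
  show ?thesis
  proof (cases "E = {}")
    case True
    then show ?thesis
      by simp
  next
    case False
    then have ne: "S \<noteq> {}"
      using ES by auto
    have "\<exists>s\<in>S. E \<subseteq> ball 0 (2 * s) \<inter> ball 0 R"
    proof (cases "\<exists>s\<in>S. R \<le> s")
      case True
      then obtain s where "s \<in> S" "R \<le> s"
        by auto
      moreover then have "E \<subseteq> ball 0 (2 * s) \<inter> ball 0 R"
        using E R by force
      ultimately show ?thesis
        by auto
    next
      case False
      then have bdd: "bdd_above S"
        by (auto simp: bdd_above_def intro!: exI[of _ R])
      have pos: "0 < Sup S"
        using ne bdd cSup_upper[OF _ bdd] unfolding S_def by fastforce
      then obtain s where s: "s \<in> S" "Sup S / 2 < s"
        using less_cSup_iff[OF ne bdd, of "Sup S / 2"] by auto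
      have "norm x < 2 * s" if "x \<in> E" for x
        using ES[OF that] cSup_upper[OF _ bdd] s by fastforce
      then show ?thesis
        using s(1) E by (intro bexI[of _ s]) auto
    qed
    then obtain s where s: "0 < s" "t < avg f 0 s" and Es: "E \<subseteq> ball 0 (2 * s) \<inter> ball 0 R"
      by (auto simp: S_def)
    let ?n = "LM_norm p \<phi> w (absf (indicator (ball 0 (2 * s))))"
    have "avg f 0 s \<le> ennreal (2 ^ DIM('a)) * avg f 0 (2 * s)"
      using s by (intro avg_enlarge subset_ball) auto
    with s(2) have "t * ?n \<le> ennreal (2 ^ DIM('a)) * avg f 0 (2 * s) * ?n"
      by (intro mult_right_mono) auto
    also have "\<dots> \<le> ennreal (2 ^ DIM('a)) * (A_const p \<phi> w * LM_norm p \<phi> w (absf f))"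
      unfolding mult.assoc using s by (intro mult_left_mono avg_LM_norm_le p meas K f) auto
    finally have tn: "epowr (t * ?n) p \<le> epowr (ennreal (2 ^ DIM('a)) * (A_const p \<phi> w * LM_norm p \<phi> w (absf f))) p"
      using p by (intro epowr_mono) auto
    have "epowr t p * (\<integral>\<^sup>+x\<in>E. ennreal (w x) \<partial>lebesgue)
      \<le> epowr t p * (\<integral>\<^sup>+x\<in>ball 0 (2 * s) \<inter> ball 0 R. ennreal (w x) \<partial>lebesgue)"
      using Es by (intro mult_left_mono nn_integral_mono) (auto simp: indicator_def)
    also have "\<dots> \<le> epowr t p * (epowr ?n p * ennreal (\<phi> (ball 0 R)))"
      by (intro mult_left_mono measure_ball_inter_le p R) simp
    also have "\<dots> = epowr (t * ?n) p * ennreal (\<phi> (ball 0 R))"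
      by (simp add: epowr_mult mult.assoc)
    also have "\<dots> \<le> epowr (ennreal (2 ^ DIM('a)) * (A_const p \<phi> w * LM_norm p \<phi> w (absf f))) p * ennreal (\<phi> (ball 0 R))"
      by (intro mult_right_mono tn) simp
    finally show ?thesis .
  qed
qed

lemma avg_local_or_central:
  assumes i: "0 < snd i" "x \<in> ball (fst i) (snd i)" and x: "x \<in> ball 0 R"
  shows "i \<in> local_balls R \<or> avg f (fst i) (snd i) \<le> ennreal (17 ^ DIM('a)) * central_maximal f x"
proof (cases "16 * snd i < norm (fst i)")
  case True
  have "norm (fst i - x) < snd i" "norm x < R"
    using i x by (auto simp: dist_norm)
  then have "2 * norm (fst i) < 3 * R"
    using norm_triangle_ineq[of "fst i - x" x] norm_ge_zero[of x] True
    unfolding diff_add_cancel by linarith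
  with True i show ?thesis
    by (simp add: local_balls_def)
next
  case False
  have sub: "ball (fst i) (snd i) \<subseteq> ball 0 (17 * snd i)"
  proof
    fix y assume "y \<in> ball (fst i) (snd i)"
    then have "norm (y - fst i) < snd i"
      by (auto simp: dist_norm norm_minus_commute)
    then show "y \<in> ball 0 (17 * snd i)"
      using norm_triangle_ineq[of "y - fst i" "fst i"] False by simp
  qed
  then have "avg f (fst i) (snd i) \<le> ennreal (17 ^ DIM('a)) * avg f 0 (17 * snd i)"
    using i by (intro avg_enlarge) auto
  also have "\<dots> \<le> ennreal (17 ^ DIM('a)) * central_maximal f x"
    unfolding central_maximal_def using i sub by (intro mult_left_mono SUP_upper) auto
  finally show ?thesis ..
qed

text \<open>The p-th power of the constant in the weak bound. The first summand belongs to the local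
  balls, the second to the central ones; 34 is 17 from the enlargement to a central ball times 2
  from \<open>weak_central\<close>. Nothing depends on w.\<close>

definition weak_constant :: "real \<Rightarrow> ennreal" where
  "weak_constant p = ennreal (Q * D ^ 3) * epowr (ennreal (5 ^ DIM('a))) p
     + epowr (ennreal (34 ^ DIM('a))) p"

text \<open>A point of B(0, R) where the maximal function exceeds t lies in a local ball with mean
  above t, or its central maximal function exceeds t / 17^n.\<close>

lemma maximal_weak_type:
  assumes p: "0 < p" and meas [measurable]: "w \<in> borel_measurable lebesgue" "f \<in> borel_measurable lebesgue"
    and K: "A_const p \<phi> w < top" and f: "LM_norm p \<phi> w (absf f) < top"
  shows "WLM_norm p \<phi> w (maximal f)
    \<le> epowr (weak_constant p) (1 / p) * (A_const p \<phi> w * LM_norm p \<phi> w (absf f))"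
  unfolding WLM_norm_le_iff[OF p]
proof (intro allI impI)
  fix R t :: real assume R: "0 < R" and t: "0 < t"
  let ?KN = "A_const p \<phi> w * LM_norm p \<phi> w (absf f)"
  let ?u = "ennreal (t / 17 ^ DIM('a))"
  define U where "U = (\<Union>i\<in>{i \<in> local_balls R. ennreal t < avg f (fst i) (snd i)}. ball (fst i) (snd i))"
  define E where "E = {x \<in> ball 0 R. ?u < central_maximal f x}"
  have "open U"
    by (auto simp: U_def)
  then have [measurable]: "U \<in> sets lebesgue"
    by simp
  have "E = {x \<in> space lebesgue. x \<in> ball 0 R \<and> ?u < central_maximal f x}"
    by (auto simp: E_def)
  also have "\<dots> \<in> sets lebesgue"
    by measurable
  finally have [measurable]: "E \<in> sets lebesgue" .
  have tu: "ennreal t = ennreal (17 ^ DIM('a)) * ?u"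
    using t by (simp flip: ennreal_mult)
  have sub: "x \<in> U \<union> E" if x: "x \<in> ball 0 R" "ennreal t < maximal f x" for x
  proof -
    obtain i where i: "0 < snd i" "x \<in> ball (fst i) (snd i)" "ennreal t < avg f (fst i) (snd i)"
      using x(2) unfolding maximal_eq_SUP_avg less_SUP_iff by blast
    from avg_local_or_central[OF i(1,2) x(1), of f] show ?thesis
    proof
      assume "i \<in> local_balls R"
      then show ?thesis
        using i unfolding U_def by blast
    next
      assume "avg f (fst i) (snd i) \<le> ennreal (17 ^ DIM('a)) * central_maximal f x"
      with i(3) have "ennreal (17 ^ DIM('a)) * ?u < ennreal (17 ^ DIM('a)) * central_maximal f x"
        unfolding tu by (rule order_less_le_trans)
      then have "?u < central_maximal f x"
        by (meson mult_left_mono not_le zero_le)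
      then show ?thesis
        using x by (simp add: E_def)
    qed
  qed
  have "(\<integral>\<^sup>+x\<in>{x \<in> ball 0 R. maximal f x > ennreal t}. ennreal (w x) \<partial>lebesgue)
    \<le> (\<integral>\<^sup>+x. ennreal (w x) * indicator U x + ennreal (w x) * indicator E x \<partial>lebesgue)"
  proof (rule nn_integral_mono)
    fix x
    show "ennreal (w x) * indicator {x \<in> ball 0 R. maximal f x > ennreal t} x
      \<le> ennreal (w x) * indicator U x + ennreal (w x) * indicator E x"
      using sub[of x] by (auto simp: indicator_def)
  qed
  also have "\<dots> = (\<integral>\<^sup>+x\<in>U. ennreal (w x) \<partial>lebesgue) + (\<integral>\<^sup>+x\<in>E. ennreal (w x) \<partial>lebesgue)"
    by (rule nn_integral_add) measurable
  finally have "epowr (ennreal t) p * (\<integral>\<^sup>+x\<in>{x \<in> ball 0 R. maximal f x > ennreal t}. ennreal (w x) \<partial>lebesgue)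
    \<le> epowr (ennreal t) p * ((\<integral>\<^sup>+x\<in>U. ennreal (w x) \<partial>lebesgue) + (\<integral>\<^sup>+x\<in>E. ennreal (w x) \<partial>lebesgue))"
    by (rule mult_left_mono) simp
  also have "\<dots> = epowr (ennreal t) p * (\<integral>\<^sup>+x\<in>U. ennreal (w x) \<partial>lebesgue)
      + epowr (ennreal (17 ^ DIM('a))) p * (epowr ?u p * (\<integral>\<^sup>+x\<in>E. ennreal (w x) \<partial>lebesgue))"
    by (simp only: distrib_left tu epowr_mult mult.assoc)
  also have "\<dots> \<le> ennreal (Q * D ^ 3) * epowr (ennreal (5 ^ DIM('a))) p * epowr ?KN p * ennreal (\<phi> (ball 0 R))
      + epowr (ennreal (17 ^ DIM('a))) p * (epowr (ennreal (2 ^ DIM('a)) * ?KN) p * ennreal (\<phi> (ball 0 R)))"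
    unfolding U_def E_def
    by (intro add_mono mult_left_mono weak_local weak_central p meas K f R) auto
  also have "\<dots> = ennreal (Q * D ^ 3) * epowr (ennreal (5 ^ DIM('a))) p * epowr ?KN p * ennreal (\<phi> (ball 0 R))
      + epowr (ennreal (17 ^ DIM('a)) * ennreal (2 ^ DIM('a))) p * epowr ?KN p * ennreal (\<phi> (ball 0 R))"
    by (simp only: epowr_mult mult.assoc)
  also have "ennreal (17 ^ DIM('a)) * ennreal (2 ^ DIM('a)) = ennreal (34 ^ DIM('a))"
    by (simp flip: ennreal_mult power_mult_distrib)
  also have "ennreal (Q * D ^ 3) * epowr (ennreal (5 ^ DIM('a))) p * epowr ?KN p * ennreal (\<phi> (ball 0 R))
      + epowr (ennreal (34 ^ DIM('a))) p * epowr ?KN p * ennreal (\<phi> (ball 0 R))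
    = weak_constant p * epowr ?KN p * ennreal (\<phi> (ball 0 R))"
    by (simp only: weak_constant_def distrib_right)
  also have "weak_constant p = epowr (epowr (weak_constant p) (1 / p)) p"
    using p by (simp add: epowr_epowr)
  finally show "epowr (ennreal t) p * (\<integral>\<^sup>+x\<in>{x \<in> ball 0 R. maximal f x > ennreal t}. ennreal (w x) \<partial>lebesgue)
    \<le> epowr (epowr (weak_constant p) (1 / p) * ?KN) p * ennreal (\<phi> (ball 0 R))"
    by (simp only: epowr_mult)
qed

section \<open>Chebyshev's inequality and necessity of the A-condition\<close>

lemma WLM_norm_le_LM_norm:
  assumes p: "0 < p" and [measurable]: "w \<in> borel_measurable lebesgue" "g \<in> borel_measurable lebesgue"
  shows "WLM_norm p \<phi> w g \<le> LM_norm p \<phi> w g"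
  unfolding WLM_norm_le_iff[OF p]
proof (intro allI impI)
  fix R t :: real assume R: "0 < R" and t: "0 < t"
  let ?E = "{x \<in> ball 0 R. ennreal t < g x}"
  have "?E = {x \<in> space lebesgue. x \<in> ball 0 R \<and> ennreal t < g x}"
    by auto
  also have "\<dots> \<in> sets lebesgue"
    by measurable
  finally have [measurable]: "?E \<in> sets lebesgue" .
  have "epowr (ennreal t) p * (\<integral>\<^sup>+x\<in>?E. ennreal (w x) \<partial>lebesgue)
    = (\<integral>\<^sup>+x. epowr (ennreal t) p * (ennreal (w x) * indicator ?E x) \<partial>lebesgue)"
    by (rule nn_integral_cmult[symmetric]) measurable
  also have "\<dots> \<le> (\<integral>\<^sup>+x\<in>ball 0 R. epowr (g x) p * ennreal (w x) \<partial>lebesgue)"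
  proof (rule nn_integral_mono)
    fix x
    show "epowr (ennreal t) p * (ennreal (w x) * indicator ?E x)
      \<le> epowr (g x) p * ennreal (w x) * indicator (ball 0 R) x"
      using epowr_mono[of "ennreal t" "g x" p] p by (auto simp: indicator_def intro!: mult_right_mono)
  qed
  also have "\<dots> \<le> epowr (LM_norm p \<phi> w g) p * ennreal (\<phi> (ball 0 R))"
    by (rule nn_integral_le_LM_norm[OF p R])
  finally show "epowr (ennreal t) p * (\<integral>\<^sup>+x\<in>?E. ennreal (w x) \<partial>lebesgue)
    \<le> epowr (LM_norm p \<phi> w g) p * ennreal (\<phi> (ball 0 R))" .
qed

text \<open>For every R the part of B inside B(0, R) lies in the superlevel set at height t, so one
  t serves all scales.\<close>

lemma LM_norm_indicator_le_WLM_norm: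
  assumes p: "0 < p" and t: "0 < t" and B: "\<And>x. x \<in> B \<Longrightarrow> ennreal t < g x"
  shows "ennreal t * LM_norm p \<phi> w (absf (indicator B)) \<le> WLM_norm p \<phi> w g"
proof -
  have "LM_norm p \<phi> w (absf (indicator B)) \<le> ennreal (1 / t) * WLM_norm p \<phi> w g"
    unfolding LM_norm_le_iff[OF p]
  proof (intro allI impI)
    fix R :: real assume R: "0 < R"
    have "(\<integral>\<^sup>+x\<in>ball 0 R. epowr (absf (indicator B) x) p * ennreal (w x) \<partial>lebesgue)
      \<le> (\<integral>\<^sup>+x\<in>{x \<in> ball 0 R. g x > ennreal t}. ennreal (w x) \<partial>lebesgue)"
      using B by (intro nn_integral_mono) (auto simp: indicator_def)
    also have "\<dots> = epowr (ennreal (1 / t) * ennreal t) p * \<dots>"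
      using t by (simp flip: ennreal_mult)
    also have "\<dots> \<le> epowr (ennreal (1 / t)) p * (epowr (WLM_norm p \<phi> w g) p * ennreal (\<phi> (ball 0 R)))"
      unfolding epowr_mult mult.assoc
      using WLM_norm_le_iff[OF p, of w g "WLM_norm p \<phi> w g"] R t by (intro mult_left_mono) auto
    finally show "(\<integral>\<^sup>+x\<in>ball 0 R. epowr (absf (indicator B) x) p * ennreal (w x) \<partial>lebesgue)
      \<le> epowr (ennreal (1 / t) * WLM_norm p \<phi> w g) p * ennreal (\<phi> (ball 0 R))"
      by (simp only: epowr_mult mult.assoc)
  qed
  then have "ennreal t * LM_norm p \<phi> w (absf (indicator B)) \<le> ennreal t * (ennreal (1 / t) * WLM_norm p \<phi> w g)"
    by (rule mult_left_mono) simp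
  also have "\<dots> = WLM_norm p \<phi> w g"
    using t by (simp flip: mult.assoc ennreal_mult)
  finally show ?thesis .
qed

text \<open>On B the maximal function is at least the mean of f, whereas the weak norm asks for
  strict excess over a level. Levels t below the mean are used and their supremum is taken, which
  also deals with an infinite mean.\<close>

lemma A_const_le_opnorm:
  assumes p: "0 < p"
  shows "A_const p \<phi> w \<le> M_opnorm_WLM p \<phi> w"
  unfolding A_const_def
proof (rule SUP_least)
  fix B :: "'a set" assume "B \<in> {B. is_ball B}"
  then obtain c r where B: "0 < r" "B = ball c r"
    by (auto simp: is_ball_def)
  let ?n = "LM_norm p \<phi> w (absf (indicator B))"
  \<comment> \<open>Factor and divisor move inside the supremum of the dual norm, so that one test
    function f can be treated at a time.\<close>
  have "?n * LM_dual_norm p \<phi> w (indicator B) / emeasure lebesgue B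
    = (SUP f\<in>{f \<in> borel_measurable lebesgue. LM_norm p \<phi> w (absf f) \<le> 1}.
      ?n * (\<integral>\<^sup>+x. ennreal \<bar>f x * indicator B x\<bar> \<partial>lebesgue) / emeasure lebesgue B)"
    unfolding LM_dual_norm_def by (simp only: SUP_mult_left_ennreal SUP_divide_ennreal)
  also have "\<dots> \<le> M_opnorm_WLM p \<phi> w"
  proof (rule SUP_least)
    fix f assume f: "f \<in> {f \<in> borel_measurable lebesgue. LM_norm p \<phi> w (absf f) \<le> 1}"
    have "(\<integral>\<^sup>+x. ennreal \<bar>f x * indicator B x\<bar> \<partial>lebesgue) = (\<integral>\<^sup>+x\<in>B. ennreal \<bar>f x\<bar> \<partial>lebesgue)"
      by (intro nn_integral_cong) (auto simp: indicator_def)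
    then have "?n * (\<integral>\<^sup>+x. ennreal \<bar>f x * indicator B x\<bar> \<partial>lebesgue) / emeasure lebesgue B = avg f c r * ?n"
      by (simp only: avg_def B divide_ennreal_def mult_ac)
    also have "\<dots> \<le> WLM_norm p \<phi> w (maximal f)"
    proof (rule ccontr)
      assume "\<not> avg f c r * ?n \<le> WLM_norm p \<phi> w (maximal f)"
      then have less: "WLM_norm p \<phi> w (maximal f) < avg f c r * ?n"
        by simp
      have sup: "avg f c r = (SUP t\<in>{t. 0 < t \<and> ennreal t < avg f c r}. ennreal t)"
      proof (rule antisym)
        show "avg f c r \<le> (SUP t\<in>{t. 0 < t \<and> ennreal t < avg f c r}. ennreal t)"
        proof (rule dense_le)
          fix y assume "y < avg f c r"
          then obtain z where z: "y < z" "z < avg f c r"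
            using dense by blast
          then obtain t where t: "z = ennreal t"
            by (cases z) auto
          moreover have "0 < z"
            using z(1) by (rule order_le_less_trans[OF zero_le])
          ultimately show "y \<le> (SUP t\<in>{t. 0 < t \<and> ennreal t < avg f c r}. ennreal t)"
            using z by (intro SUP_upper2[of t]) auto
        qed
        show "(SUP t\<in>{t. 0 < t \<and> ennreal t < avg f c r}. ennreal t) \<le> avg f c r"
          by (rule SUP_least) auto
      qed
      have "avg f c r * ?n = (SUP t\<in>{t. 0 < t \<and> ennreal t < avg f c r}. ennreal t * ?n)"
        by (subst (1) sup) (rule SUP_mult_right_ennreal)
      with less obtain t where t: "0 < t" "ennreal t < avg f c r" "WLM_norm p \<phi> w (maximal f) < ennreal t * ?n"
        by (auto simp: less_SUP_iff)
      have "ennreal t < maximal f x" if "x \<in> B" for x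
      proof -
        have "avg f c r \<le> maximal f x"
          unfolding maximal_eq_SUP_avg using that B by (intro SUP_upper2[of "(c, r)"]) auto
        with t(2) show ?thesis
          by (rule order_less_le_trans)
      qed
      then have "ennreal t * ?n \<le> WLM_norm p \<phi> w (maximal f)"
        by (intro LM_norm_indicator_le_WLM_norm p t)
      with t(3) show False
        by simp
    qed
    also have "\<dots> \<le> M_opnorm_WLM p \<phi> w"
      unfolding M_opnorm_WLM_def using f by (rule SUP_upper)
    finally show "?n * (\<integral>\<^sup>+x. ennreal \<bar>f x * indicator B x\<bar> \<partial>lebesgue) / emeasure lebesgue B \<le> M_opnorm_WLM p \<phi> w" .
  qed
  finally show "?n * LM_dual_norm p \<phi> w (indicator B) / emeasure lebesgue B \<le> M_opnorm_WLM p \<phi> w" .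
qed

end

subsection \<open>Strong type estimates\<close>

lemma weight_ball_finite:
  assumes "weight w"
  shows "(\<integral>\<^sup>+x\<in>ball c r. ennreal (w x) \<partial>lebesgue) < top"
proof -
  have "integrable lebesgue (\<lambda>x. indicator (ball c r) x *\<^sub>R w x)" and w0: "\<And>x. 0 \<le> w x"
    using assms by (auto simp: weight_def set_integrable_def)
  then have "(\<integral>\<^sup>+x. ennreal (norm (indicator (ball c r) x *\<^sub>R w x)) \<partial>lebesgue) < top"
    by (simp add: integrable_iff_bounded)
  also have "(\<integral>\<^sup>+x. ennreal (norm (indicator (ball c r) x *\<^sub>R w x)) \<partial>lebesgue) = (\<integral>\<^sup>+x\<in>ball c r. ennreal (w x) \<partial>lebesgue)"
    using w0 by (intro nn_integral_cong) (auto simp: indicator_def)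
  finally show ?thesis .
qed

lemma is_ball_ball: "0 < r \<Longrightarrow> is_ball (ball c r)"
  unfolding is_ball_def by blast

section \<open>Strong bound for central balls: annuli and reverse doubling\<close>

context radial_growth
begin

text \<open>Let h be the norm of the characteristic function of B(0, s/2). A central ball containing
  a point of the annulus contains B(0, s/2), so the A-condition bounds the central maximal function
  there by K times the norm of f, divided by h. The w-mass of B(0, s) is at most (2^n K h)^p
  \<phi>(B(0, s)). In the product h cancels, and K appears twice.\<close>

lemma central_maximal_annulus:
  assumes p: "0 < p" and meas [measurable]: "w \<in> borel_measurable lebesgue" "f \<in> borel_measurable lebesgue"
    and K: "A_const p \<phi> w < top" and f: "LM_norm p \<phi> w (absf f) < top" and s: "0 < s"
    and fin: "\<And>B. is_ball B \<Longrightarrow> LM_norm p \<phi> w (absf (indicator B)) < top"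
  shows "(\<integral>\<^sup>+x\<in>ball 0 s - ball 0 (s / 2). epowr (central_maximal f x) p * ennreal (w x) \<partial>lebesgue)
    \<le> epowr (ennreal (2 ^ DIM('a)) * A_const p \<phi> w * (A_const p \<phi> w * LM_norm p \<phi> w (absf f))) p
      * ennreal (\<phi> (ball 0 s))"
proof -
  let ?A = "ball 0 s - ball (0::'a) (s / 2)"
  let ?KN = "A_const p \<phi> w * LM_norm p \<phi> w (absf f)"
  let ?n = "\<lambda>s. LM_norm p \<phi> w (absf (indicator (ball 0 s)))"
  let ?L = "\<integral>\<^sup>+x\<in>?A. epowr (central_maximal f x) p * ennreal (w x) \<partial>lebesgue"
  let ?W = "\<integral>\<^sup>+x\<in>ball 0 s. ennreal (w x) \<partial>lebesgue"
  define h where "h = ?n (s / 2)"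
  have h_top: "h < top"
    unfolding h_def using s by (intro fin is_ball_ball) auto
  \<comment> \<open>This test function has mean at least 2^(-n) over B(0, s), so the A-condition
    bounds \<open>?n s\<close> by 2^n K \<open>h\<close>.\<close>
  let ?i = "indicator (ball (0::'a) (s / 2)) :: 'a \<Rightarrow> real"
  have "avg ?i 0 (s / 2) * emeasure lebesgue (ball (0::'a) (s / 2)) = emeasure lebesgue (ball (0::'a) (s / 2))"
  proof -
    have "(\<integral>\<^sup>+x\<in>ball 0 (s / 2). ennreal \<bar>?i x\<bar> \<partial>lebesgue) = (\<integral>\<^sup>+x. indicator (ball (0::'a) (s / 2)) x \<partial>lebesgue)"
      by (intro nn_integral_cong) (auto simp: indicator_def)
    then show ?thesis
      using s by (subst avg_mult_measure) auto
  qed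
  then have "1 * emeasure lebesgue (ball (0::'a) (s / 2)) \<le> avg ?i 0 (s / 2) * emeasure lebesgue (ball (0::'a) (s / 2))"
    by (simp only: mult_1 order_refl)
  then have "1 \<le> avg ?i 0 (s / 2)"
    by (rule mult_right_le_cancel_ennreal)
       (use s emeasure_lebesgue_ball_pos[of "s / 2" 0] emeasure_lebesgue_ball_finite[of 0 "s / 2"] in auto)
  also have "\<dots> \<le> ennreal (2 ^ DIM('a)) * avg ?i 0 (2 * (s / 2))"
    using s by (intro avg_enlarge subset_ball) auto
  finally have "1 * ?n s \<le> ennreal (2 ^ DIM('a)) * avg ?i 0 s * ?n s"
    by (intro mult_right_mono) auto
  also have "\<dots> \<le> ennreal (2 ^ DIM('a)) * (A_const p \<phi> w * h)"
    unfolding mult.assoc h_def using s h_top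
    by (intro mult_left_mono avg_LM_norm_le p meas K) (auto simp: h_def)
  finally have n_le: "?n s \<le> ennreal (2 ^ DIM('a)) * A_const p \<phi> w * h"
    by (simp add: mult.assoc)
  have "?W \<le> epowr (?n s) p * ennreal (\<phi> (ball 0 s))"
    using measure_ball_inter_le[OF p s, of w "ball 0 s"] by simp
  also have "\<dots> \<le> epowr (ennreal (2 ^ DIM('a)) * A_const p \<phi> w * h) p * ennreal (\<phi> (ball 0 s))"
    using p by (intro mult_right_mono epowr_mono n_le) auto
  finally have W: "?W \<le> epowr (ennreal (2 ^ DIM('a)) * A_const p \<phi> w * h) p * ennreal (\<phi> (ball 0 s))" .
  show ?thesis
  proof (cases "h = 0")
    case True
    then have "?W = 0"
      using W by simp
    then have "?L = 0"
      by (rule nn_integral_zero_subset[rotated 2]) auto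
    then show ?thesis
      by simp
  next
    case False
    have hp: "0 < epowr h p" "epowr h p < top"
      using False h_top by (auto simp: zero_less_iff_neq_zero less_top[symmetric])
    have ptw: "central_maximal f x * h \<le> ?KN" if "x \<notin> ball 0 (s / 2)" for x
      unfolding central_maximal_def SUP_mult_right_ennreal
    proof (rule SUP_least)
      fix u assume u: "u \<in> {s \<in> {0<..}. x \<in> ball 0 s}"
      have "ball (0::'a) (s / 2) \<subseteq> ball 0 u"
        using u that by (intro subset_ball) auto
      then have "h \<le> ?n u"
        unfolding h_def by (intro LM_norm_mono p) (auto simp: indicator_def)
      then have "avg f 0 u * h \<le> avg f 0 u * ?n u"
        by (rule mult_left_mono) simp
      also have "\<dots> \<le> ?KN"
        using u by (intro avg_LM_norm_le p meas K f) auto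
      finally show "avg f 0 u * h \<le> ?KN" .
    qed
    have "?L * epowr h p = (\<integral>\<^sup>+x. epowr (central_maximal f x) p * ennreal (w x) * indicator ?A x * epowr h p \<partial>lebesgue)"
      by (rule nn_integral_multc[symmetric]) measurable
    also have "\<dots> \<le> (\<integral>\<^sup>+x. epowr ?KN p * (ennreal (w x) * indicator (ball 0 s) x) \<partial>lebesgue)"
    proof (rule nn_integral_mono)
      fix x
      show "epowr (central_maximal f x) p * ennreal (w x) * indicator ?A x * epowr h p
        \<le> epowr ?KN p * (ennreal (w x) * indicator (ball 0 s) x)"
      proof (cases "x \<in> ?A")
        case True
        then have "epowr (central_maximal f x * h) p * ennreal (w x) \<le> epowr ?KN p * ennreal (w x)"
          using p by (intro mult_right_mono epowr_mono ptw) auto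
        then show ?thesis
          using True by (simp add: epowr_mult mult_ac)
      qed simp
    qed
    also have "\<dots> = epowr ?KN p * ?W"
      by (rule nn_integral_cmult) measurable
    also have "\<dots> \<le> epowr ?KN p * (epowr (ennreal (2 ^ DIM('a)) * A_const p \<phi> w * h) p * ennreal (\<phi> (ball 0 s)))"
      by (rule mult_left_mono[OF W]) simp
    also have "\<dots> = epowr (ennreal (2 ^ DIM('a)) * A_const p \<phi> w * ?KN) p * ennreal (\<phi> (ball 0 s)) * epowr h p"
      by (simp only: epowr_mult mult_ac)
    finally show ?thesis
      using hp by (rule mult_right_le_cancel_ennreal)
  qed
qed

text \<open>The annuli with outer radii R / 2^j exhaust B(0, R) except for the origin, a null set,
  and reverse doubling gives the j-th one the factor 2^(-\<epsilon> j).\<close>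

lemma central_maximal_strong_type:
  assumes p: "0 < p" and meas [measurable]: "w \<in> borel_measurable lebesgue" "f \<in> borel_measurable lebesgue"
    and K: "A_const p \<phi> w < top" and f: "LM_norm p \<phi> w (absf f) < top" and R: "0 < R"
    and fin: "\<And>B. is_ball B \<Longrightarrow> LM_norm p \<phi> w (absf (indicator B)) < top"
  shows "(\<integral>\<^sup>+x\<in>ball 0 R. epowr (central_maximal f x) p * ennreal (w x) \<partial>lebesgue)
    \<le> (\<Sum>j. ennreal (((1 / 2) powr \<epsilon>) ^ j)) * ennreal Q
      * epowr (ennreal (2 ^ DIM('a)) * A_const p \<phi> w * (A_const p \<phi> w * LM_norm p \<phi> w (absf f))) p
      * ennreal (\<phi> (ball 0 R))"
proof -
  let ?A = "\<lambda>j::nat. ball 0 (R / 2 ^ j) - ball (0::'a) (R / 2 ^ j / 2)"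
  let ?g = "\<lambda>x. epowr (central_maximal f x) p * ennreal (w x)"
  define C where "C = epowr (ennreal (2 ^ DIM('a)) * A_const p \<phi> w * (A_const p \<phi> w * LM_norm p \<phi> w (absf f))) p"
  have cover: "\<exists>j. x \<in> ?A j" if "x \<noteq> 0" "x \<in> ball 0 R" for x
  proof -
    \<comment> \<open>For the least such j, minimality yields the outer bound of the annulus; for j
      = 0 that bound is \<open>x \<in> ball 0 R\<close>.\<close>
    let ?P = "\<lambda>j. R / 2 ^ j / 2 \<le> norm x"
    have "\<exists>j. ?P j"
    proof -
      obtain n where "R / norm x < 2 ^ n"
        using real_arch_pow[of 2 "R / norm x"] by auto
      then have "R / 2 ^ n / 2 \<le> norm x"
        using that R by (simp add: field_simps)
      then show ?thesis ..
    qed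
    then have P: "?P (LEAST j. ?P j)"
      by (rule LeastI_ex)
    have "norm x < R / 2 ^ (LEAST j. ?P j)"
    proof (cases "LEAST j. ?P j")
      case 0
      then show ?thesis
        using that by simp
    next
      case (Suc k)
      then have "\<not> ?P k"
        by (intro not_less_Least) simp
      then show ?thesis
        using Suc by (simp add: field_simps)
    qed
    with P show ?thesis
      by (intro exI[of _ "LEAST j. ?P j"]) auto
  qed
  have "AE x in lebesgue. x \<noteq> (0::'a)"
    by (intro AE_completion AE_lborel_singleton)
  then have "AE x in lebesgue. ?g x * indicator (ball 0 R) x \<le> (\<Sum>j. ?g x * indicator (?A j) x)"
  proof eventually_elim
    fix x :: 'a assume x: "x \<noteq> 0"
    show "?g x * indicator (ball 0 R) x \<le> (\<Sum>j. ?g x * indicator (?A j) x)"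
    proof (cases "x \<in> ball 0 R")
      case True
      then obtain j where "x \<in> ?A j"
        using cover x by blast
      then have "?g x * indicator (ball 0 R) x \<le> (\<Sum>j\<in>{j}. ?g x * indicator (?A j) x)"
        using True by simp
      also have "\<dots> \<le> (\<Sum>j. ?g x * indicator (?A j) x)"
        by (rule sum_le_suminf) auto
      finally show ?thesis .
    qed simp
  qed
  then have "(\<integral>\<^sup>+x\<in>ball 0 R. ?g x \<partial>lebesgue) \<le> (\<integral>\<^sup>+x. (\<Sum>j. ?g x * indicator (?A j) x) \<partial>lebesgue)"
    by (rule nn_integral_mono_AE)
  also have "\<dots> = (\<Sum>j. \<integral>\<^sup>+x\<in>?A j. ?g x \<partial>lebesgue)"
    by (rule nn_integral_suminf) measurable
  also have "\<dots> \<le> (\<Sum>j. ennreal (((1 / 2) powr \<epsilon>) ^ j) * (ennreal Q * C * ennreal (\<phi> (ball 0 R))))"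
  proof (rule suminf_le)
    fix j :: nat
    have "(\<integral>\<^sup>+x\<in>?A j. ?g x \<partial>lebesgue) \<le> C * ennreal (\<phi> (ball 0 (R / 2 ^ j)))"
      unfolding C_def using R by (intro central_maximal_annulus p meas K f fin) auto
    also have "\<dots> \<le> C * ennreal (Q * ((1 / 2) powr \<epsilon>) ^ j * \<phi> (ball 0 R))"
    proof (intro mult_left_mono ennreal_leI)
      have "\<phi> (ball 0 (R / 2 ^ j)) \<le> Q * (R / 2 ^ j / R) powr \<epsilon> * \<phi> (ball 0 R)"
        using R by (intro \<phi>_reverse) (auto simp: field_simps)
      also have "(R / 2 ^ j / R) powr \<epsilon> = ((1 / 2) powr \<epsilon>) ^ j"
      proof -
        have "R / 2 ^ j / R = (1 / 2) powr real j"
          using R by (simp add: powr_realpow power_divide)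
        then show ?thesis
          by (simp add: powr_powr powr_power mult.commute)
      qed
      finally show "\<phi> (ball 0 (R / 2 ^ j)) \<le> Q * ((1 / 2) powr \<epsilon>) ^ j * \<phi> (ball 0 R)" .
    qed simp
    also have "\<dots> = ennreal (((1 / 2) powr \<epsilon>) ^ j) * (ennreal Q * C * ennreal (\<phi> (ball 0 R)))"
      using Q_pos \<phi>_pos[OF R] by (simp add: ennreal_mult mult_ac)
    finally show "(\<integral>\<^sup>+x\<in>?A j. ?g x \<partial>lebesgue)
      \<le> ennreal (((1 / 2) powr \<epsilon>) ^ j) * (ennreal Q * C * ennreal (\<phi> (ball 0 R)))" .
  qed auto
  also have "\<dots> = (\<Sum>j. ennreal (((1 / 2) powr \<epsilon>) ^ j)) * (ennreal Q * C * ennreal (\<phi> (ball 0 R)))"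
    by (rule ennreal_suminf_multc)
  finally show ?thesis
    by (simp add: C_def mult.assoc)
qed

lemma geometric_finite: "(\<Sum>j. ennreal (((1 / 2) powr \<epsilon>) ^ j)) < top"
proof -
  have "(1 / 2 :: real) powr \<epsilon> < 1 powr \<epsilon>"
    using \<epsilon>_pos by (intro powr_less_mono2) auto
  then have "summable (\<lambda>j. ((1 / 2) powr \<epsilon>) ^ j)"
    by (intro summable_geometric) simp
  then have "(\<Sum>j. ennreal (((1 / 2) powr \<epsilon>) ^ j)) \<noteq> top"
    by (intro ennreal_suminf_neq_top) auto
  then show ?thesis
    by (simp add: less_top)
qed

text \<open>If w vanishes on a set Z of positive measure, the characteristic function of Z has norm
  0. The A-condition on a large ball that contains a non-null part of Z then makes the norm of the
  characteristic function of this ball 0, so w is 0 almost everywhere on it.\<close>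

lemma weight_AE_zero_or_pos:
  assumes p: "0 < p" and meas [measurable]: "w \<in> borel_measurable lebesgue" and w0: "\<And>x. 0 \<le> w x"
    and K: "A_const p \<phi> w < top"
  shows "(AE x in lebesgue. w x = 0) \<or> (AE x in lebesgue. 0 < w x)"
proof (cases "\<exists>n::nat. emeasure lebesgue ({x. w x = 0} \<inter> ball 0 (real n)) \<noteq> 0")
  case True
  define Z where "Z = {x. w x = 0}"
  have "Z = {x \<in> space lebesgue. w x = 0}"
    by (auto simp: Z_def)
  also have "\<dots> \<in> sets lebesgue"
    by measurable
  finally have Zm [measurable]: "Z \<in> sets lebesgue" .
  obtain k :: nat where k: "emeasure lebesgue (Z \<inter> ball 0 (real k)) \<noteq> 0"
    using True unfolding Z_def by blast
  let ?f = "indicator Z :: 'a \<Rightarrow> real"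
  have "LM_norm p \<phi> w (absf ?f) \<le> 0"
    unfolding LM_norm_le_iff[OF p]
  proof (intro allI impI)
    fix R :: real
    have "(\<integral>\<^sup>+x\<in>ball 0 R. epowr (absf ?f x) p * ennreal (w x) \<partial>lebesgue) = (\<integral>\<^sup>+(x::'a). 0 \<partial>lebesgue)"
      by (intro nn_integral_cong) (auto simp: indicator_def Z_def)
    then show "(\<integral>\<^sup>+x\<in>ball 0 R. epowr (absf ?f x) p * ennreal (w x) \<partial>lebesgue) \<le> epowr 0 p * ennreal (\<phi> (ball 0 R))"
      by simp
  qed
  then have f0: "LM_norm p \<phi> w (absf ?f) = 0"
    by simp
  have "AE x in lebesgue. x \<in> ball 0 (real n) \<longrightarrow> w x = 0" for n :: nat
  proof -
    define R where "R = real (max 1 (max n k))"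
    have R: "0 < R" "real n \<le> R" "real k \<le> R"
      by (auto simp: R_def)
    let ?n = "LM_norm p \<phi> w (absf (indicator (ball 0 R)))"
    have "(\<integral>\<^sup>+x\<in>ball 0 R. ennreal \<bar>?f x\<bar> \<partial>lebesgue) * ?n \<le> 0"
      using A_const_ball[OF p meas _ K _ R(1), of ?f 0] f0 by simp
    moreover have "(\<integral>\<^sup>+x\<in>ball 0 R. ennreal \<bar>?f x\<bar> \<partial>lebesgue) \<noteq> 0"
    proof
      assume zero: "(\<integral>\<^sup>+x\<in>ball 0 R. ennreal \<bar>?f x\<bar> \<partial>lebesgue) = 0"
      have "emeasure lebesgue (Z \<inter> ball 0 (real k)) = (\<integral>\<^sup>+x. indicator (Z \<inter> ball 0 (real k)) x \<partial>lebesgue)"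
        by (rule nn_integral_indicator[symmetric]) measurable
      also have "\<dots> \<le> (\<integral>\<^sup>+x\<in>ball 0 R. ennreal \<bar>?f x\<bar> \<partial>lebesgue)"
        using R by (intro nn_integral_mono) (auto simp: indicator_def)
      finally show False
        using k zero by simp
    qed
    ultimately have "?n = 0"
      by auto
    then have "(\<integral>\<^sup>+x\<in>ball 0 R. ennreal (w x) \<partial>lebesgue) = 0"
      using measure_ball_inter_le[OF p R(1), of w "ball 0 R"] by simp
    then have "AE x in lebesgue. ennreal (w x) * indicator (ball 0 R) x = 0"
      by (subst (asm) nn_integral_0_iff_AE) auto
    then show ?thesis
    proof eventually_elim
      fix x :: 'a assume "ennreal (w x) * indicator (ball 0 R) x = 0"
      then show "x \<in> ball 0 (real n) \<longrightarrow> w x = 0"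
        using R w0[of x] by (auto simp: indicator_def ennreal_eq_0_iff split: if_splits)
    qed
  qed
  then have "AE x in lebesgue. \<forall>n::nat. x \<in> ball 0 (real n) \<longrightarrow> w x = 0"
    unfolding AE_all_countable by (rule allI)
  then have "AE x in lebesgue. w x = 0"
  proof eventually_elim
    fix x :: 'a assume "\<forall>n::nat. x \<in> ball 0 (real n) \<longrightarrow> w x = 0"
    then show "w x = 0"
      using reals_Archimedean2[of "norm x"] by auto
  qed
  then show ?thesis ..
next
  case False
  define Z where "Z = {x. w x = 0}"
  have "Z = {x \<in> space lebesgue. w x = 0}"
    by (auto simp: Z_def)
  also have "\<dots> \<in> sets lebesgue"
    by measurable
  finally have Zm [measurable]: "Z \<in> sets lebesgue" .
  have "AE x in lebesgue. x \<notin> Z \<inter> ball 0 (real n)" for n :: nat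
    using False unfolding Z_def[symmetric] by (intro AE_not_in) (auto simp: null_sets_def)
  then have "AE x in lebesgue. \<forall>n::nat. x \<notin> Z \<inter> ball 0 (real n)"
    unfolding AE_all_countable by (rule allI)
  then have "AE x in lebesgue. 0 < w x"
  proof eventually_elim
    fix x :: 'a assume "\<forall>n::nat. x \<notin> Z \<inter> ball 0 (real n)"
    then show "0 < w x"
      using reals_Archimedean2[of "norm x"] w0[of x] by (auto simp: Z_def less_le)
  qed
  then show ?thesis ..
qed

lemma weight_ball_pos:
  fixes u :: "'a \<Rightarrow> ennreal"
  assumes [measurable]: "u \<in> borel_measurable lebesgue" and pos: "AE x in lebesgue. 0 < u x" and r: "0 < r"
  shows "0 < (\<integral>\<^sup>+x\<in>ball c r. u x \<partial>lebesgue)"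
proof (rule ccontr)
  assume "\<not> ?thesis"
  then have "(\<integral>\<^sup>+x\<in>ball c r. u x \<partial>lebesgue) = 0"
    by simp
  then have "AE x in lebesgue. u x * indicator (ball c r) x = 0"
    by (subst (asm) nn_integral_0_iff_AE) auto
  with pos have "AE x in lebesgue. x \<notin> ball c r"
    by eventually_elim (auto simp: indicator_def split: if_splits)
  then have "emeasure lebesgue (ball c r) = 0"
    by (subst (asm) AE_iff_measurable[where N="ball c r"]) auto
  then show False
    using emeasure_lebesgue_ball_pos[OF r, of c] by simp
qed

text \<open>With \<sigma> = w^(-1/(p-1)) one has \<sigma>^p w = \<sigma>, so testing
  \<open>local_Ap\<close> on \<sigma> puts the integral of \<sigma> on both sides, and one factor of
  it cancels.\<close>

lemma local_Ap_dual_weight: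
  fixes c :: 'a
  assumes p: "1 < p" and w: "weight w" and w_pos: "AE x in lebesgue. 0 < w x"
    and K: "A_const p \<phi> w < top" and r: "0 < r" "2 * r < norm c"
  shows "epowr (\<integral>\<^sup>+x\<in>ball c r. ennreal (w x powr (- 1 / (p - 1))) \<partial>lebesgue) (p - 1)
      * (\<integral>\<^sup>+x\<in>ball c r. ennreal (w x) \<partial>lebesgue)
    \<le> ennreal (Q * D\<^sup>2) * epowr (A_const p \<phi> w) p * epowr (emeasure lebesgue (ball c r)) p"
proof -
  have [measurable]: "w \<in> borel_measurable lebesgue" and w0: "\<And>x. 0 \<le> w x"
    using w by (auto simp: weight_def)
  let ?B = "ball c r"
  let ?s = "\<lambda>x. w x powr (- 1 / (p - 1))"
  define W where "W = (\<integral>\<^sup>+x\<in>?B. ennreal (w x) \<partial>lebesgue)"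
  define Y where "Y = ennreal (Q * D\<^sup>2) * epowr (A_const p \<phi> w) p * epowr (emeasure lebesgue ?B) p"
  have W_pos: "0 < W"
    unfolding W_def using r w_pos by (intro weight_ball_pos) auto
  have W_top: "W < top"
    unfolding W_def by (rule weight_ball_finite[OF w])
  \<comment> \<open>The truncations serve to cancel a finite integral; testing on the dual weight itself would
    presuppose that it is integrable.\<close>
  let ?t = "\<lambda>N::nat. \<lambda>x. min (?s x) (real N)"
  have bound: "(\<integral>\<^sup>+x\<in>?B. ennreal (?t N x) \<partial>lebesgue) \<le> epowr (Y / W) (1 / (p - 1))" for N
  proof -
    let ?S = "\<integral>\<^sup>+x\<in>?B. ennreal (?t N x) \<partial>lebesgue"
    let ?I = "\<integral>\<^sup>+x\<in>?B. epowr (absf (?t N) x) p * ennreal (w x) \<partial>lebesgue"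
    have "?S \<le> (\<integral>\<^sup>+x. ennreal (real N) * indicator ?B x \<partial>lebesgue)"
      by (intro nn_integral_mono) (auto simp: indicator_def)
    also have "\<dots> = ennreal (real N) * emeasure lebesgue ?B"
      by (rule nn_integral_cmult_indicator) simp
    also have "\<dots> < top"
      using emeasure_lebesgue_ball_finite[of c r] unfolding ennreal_mult_less_top by auto
    finally have S_top: "?S < top" .
    \<comment> \<open>For the truncated \<sigma> the identity becomes an inequality, in the useful
      direction.\<close>
    have IS: "?I \<le> ?S"
    proof (rule nn_integral_mono)
      fix x
      have "?t N x powr p * w x \<le> ?t N x"
      proof (cases "0 < w x")
        case True
        have "?t N x powr p * w x = ?t N x * (?t N x powr (p - 1) * w x)"
          by (cases "?t N x = 0") (auto simp: powr_diff min_def)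
        also have "?t N x powr (p - 1) * w x \<le> ?s x powr (p - 1) * w x"
          using p True by (intro mult_right_mono powr_mono2) auto
        also have "?s x powr (p - 1) = w x powr (- 1)"
          unfolding powr_powr using p by simp
        also have "w x powr (- 1) * w x = 1"
          using True by (simp add: powr_minus)
        finally show ?thesis
          by (simp add: mult_left_mono)
      next
        case False
        then show ?thesis
          using w0[of x] by simp
      qed
      then have "ennreal (?t N x powr p * w x) \<le> ennreal (?t N x)"
        by (rule ennreal_leI)
      then show "epowr (absf (?t N) x) p * ennreal (w x) * indicator ?B x \<le> ennreal (?t N x) * indicator ?B x"
        using w0[of x] by (auto simp: epowr_ennreal indicator_def ennreal_mult)
    qed
    have "epowr (\<integral>\<^sup>+x\<in>?B. ennreal \<bar>?t N x\<bar> \<partial>lebesgue) p * W \<le> Y * ?I"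
      unfolding W_def Y_def using p K r order_le_less_trans[OF IS S_top] by (intro local_Ap) auto
    also have "(\<integral>\<^sup>+x\<in>?B. ennreal \<bar>?t N x\<bar> \<partial>lebesgue) = ?S"
      by (intro nn_integral_cong) simp
    also have "Y * ?I \<le> Y * ?S"
      by (rule mult_left_mono[OF IS]) simp
    finally have le: "epowr ?S p * W \<le> Y * ?S" .
    have "epowr ?S (p - 1) * W \<le> Y"
    proof (cases "?S = 0")
      case False
      have "epowr ?S p = epowr ?S (p - 1) * ?S"
        using epowr_add[of ?S "p - 1" 1] by simp
      then have "epowr ?S (p - 1) * W * ?S \<le> Y * ?S"
        using le by (simp only: mult_ac)
      moreover have "0 < ?S"
        using False unfolding zero_less_iff_neq_zero .
      ultimately show ?thesis
        using S_top by (rule mult_right_le_cancel_ennreal)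
    qed simp
    then have "epowr ?S (p - 1) * W / W \<le> Y / W"
      by (rule divide_right_mono_ennreal)
    then have "epowr ?S (p - 1) \<le> Y / W"
      using W_pos W_top by (simp add: ennreal_mult_divide_eq)
    then show ?thesis
      using p by (simp add: epowr_le_iff)
  qed
  have "(\<integral>\<^sup>+x\<in>?B. ennreal (?s x) \<partial>lebesgue) = (\<integral>\<^sup>+x. (SUP N. ennreal (?t N x) * indicator ?B x) \<partial>lebesgue)"
  proof (rule nn_integral_cong)
    fix x
    obtain N :: nat where N: "?s x \<le> real N"
      using real_arch_simple by blast
    have "(SUP N. ennreal (?t N x) * indicator ?B x) = ennreal (?s x) * indicator ?B x"
    proof (rule antisym)
      show "(SUP N. ennreal (?t N x) * indicator ?B x) \<le> ennreal (?s x) * indicator ?B x"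
        by (intro SUP_least mult_right_mono ennreal_leI) auto
      show "ennreal (?s x) * indicator ?B x \<le> (SUP N. ennreal (?t N x) * indicator ?B x)"
        using N by (intro SUP_upper2[of N]) (auto simp: min_def)
    qed
    then show "ennreal (?s x) * indicator ?B x = (SUP N. ennreal (?t N x) * indicator ?B x)"
      by simp
  qed
  also have "\<dots> = (SUP N. \<integral>\<^sup>+x. ennreal (?t N x) * indicator ?B x \<partial>lebesgue)"
  proof (rule nn_integral_monotone_convergence_SUP)
    show "incseq (\<lambda>N x. ennreal (?t N x) * indicator ?B x)"
      by (auto simp: incseq_def le_fun_def intro!: mult_right_mono ennreal_leI)
  qed measurable
  also have "\<dots> \<le> epowr (Y / W) (1 / (p - 1))"
    by (rule SUP_least) (rule bound)
  finally have "epowr (\<integral>\<^sup>+x\<in>?B. ennreal (?s x) \<partial>lebesgue) (p - 1) \<le> Y / W"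
    using p by (simp add: epowr_le_iff)
  then have "epowr (\<integral>\<^sup>+x\<in>?B. ennreal (?s x) \<partial>lebesgue) (p - 1) * W \<le> Y / W * W"
    by (rule mult_right_mono) simp
  also have "\<dots> = Y"
    using W_pos W_top by (simp add: ennreal_divide_times)
  finally show ?thesis
    by (simp only: W_def Y_def)
qed

section \<open>The local maximal operator on a weighted Lebesgue space\<close>

definition local_maximal :: "real \<Rightarrow> ('a \<Rightarrow> real) \<Rightarrow> 'a \<Rightarrow> ennreal" where
  "local_maximal R f x = (SUP i\<in>{i \<in> local_balls R. x \<in> ball (fst i) (snd i)}. avg f (fst i) (snd i))"

lemma local_maximal_measurable [measurable]: "local_maximal R f \<in> borel_measurable lebesgue"
  unfolding local_maximal_def
  by (rule measurable_completion, unfold measurable_lborel2, rule measurable_SUP_open) simp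

text \<open>For a local ball B put A for the integral of |f| over B and b = A / \<sigma>(5B).
  Writing f = (f/\<sigma>) \<sigma> shows b \<le> T on all of B, so b^(p-1) |B| is at most the
  integral over B of (T^(p-1) / w) w, hence at most V w(5B). Multiplication by \<sigma>(5B)^(p-1)
  brings in the Muckenhoupt condition on 5B: A^(p-1) |B| is at most a constant times V
  |B|^p.\<close>

lemma local_maximal_pointwise:
  fixes R :: real and x :: 'a
  assumes p: "1 < p" and w: "weight w" and w_pos: "AE x in lebesgue. 0 < w x"
    and K: "A_const p \<phi> w < top" and [measurable]: "f \<in> borel_measurable lebesgue"
  defines "T \<equiv> dilated_maximal (local_balls R) (\<lambda>y. ennreal (w y powr (- 1 / (p - 1))))
      (\<lambda>y. ennreal (\<bar>f y\<bar> * w y powr (1 / (p - 1))))"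
  shows "epowr (local_maximal R f x) (p - 1)
    \<le> ennreal (Q * D\<^sup>2) * epowr (A_const p \<phi> w) p * epowr (ennreal (5 ^ DIM('a))) p
      * dilated_maximal (local_balls R) (\<lambda>y. ennreal (w y)) (\<lambda>y. epowr (T y) (p - 1) / ennreal (w y)) x"
proof -
  have [measurable]: "w \<in> borel_measurable lebesgue"
    using w by (rule weight_measurable)
  let ?s = "\<lambda>y. ennreal (w y powr (- 1 / (p - 1)))"
  let ?k = "\<lambda>y. ennreal (\<bar>f y\<bar> * w y powr (1 / (p - 1)))"
  let ?g = "\<lambda>y. epowr (T y) (p - 1) / ennreal (w y)"
  define C where "C = ennreal (Q * D\<^sup>2) * epowr (A_const p \<phi> w) p"
  define C5 where "C5 = C * epowr (ennreal (5 ^ DIM('a))) p"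
  define V where "V = dilated_maximal (local_balls R) (\<lambda>y. ennreal (w y)) ?g x"
  have [measurable]: "T \<in> borel_measurable lebesgue"
    unfolding T_def by measurable
  have "local_maximal R f x \<le> epowr (C5 * V) (1 / (p - 1))"
    unfolding local_maximal_def
  proof (rule SUP_least)
    fix i assume i: "i \<in> {i \<in> local_balls R. x \<in> ball (fst i) (snd i)}"
    define c r where "c = fst i" and "r = snd i"
    have cr: "0 < r" "16 * r < norm c" "x \<in> ball c r"
      using i by (auto simp: c_def r_def local_balls_def)
    let ?B = "ball c r" and ?B5 = "ball c (5 * r)"
    define m where "m = emeasure lebesgue ?B"
    define A where "A = (\<integral>\<^sup>+y\<in>?B. ennreal \<bar>f y\<bar> \<partial>lebesgue)"
    define S where "S = (\<integral>\<^sup>+y\<in>?B5. ?s y \<partial>lebesgue)"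
    define W where "W = (\<integral>\<^sup>+y\<in>?B5. ennreal (w y) \<partial>lebesgue)"
    define b where "b = A / S"
    have m: "0 < m" "m < top"
      unfolding m_def using cr emeasure_lebesgue_ball_pos emeasure_lebesgue_ball_finite by auto
    have W: "0 < W" "W < top"
      unfolding W_def using cr w_pos by (auto intro!: weight_ball_pos weight_ball_finite[OF w])
    have S_pos: "0 < S"
      unfolding S_def
    proof (rule weight_ball_pos)
      show "AE y in lebesgue. 0 < ?s y"
        using w_pos by eventually_elim simp
    qed (use cr in auto)
    have "epowr S (p - 1) * W \<le> C * epowr (emeasure lebesgue ?B5) p"
      unfolding S_def W_def C_def using cr by (intro local_Ap_dual_weight p w w_pos K) auto
    also have "emeasure lebesgue ?B5 = ennreal (5 ^ DIM('a)) * m"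
      unfolding m_def using cr by (intro emeasure_lebesgue_ball_scale) auto
    finally have Ap: "epowr S (p - 1) * W \<le> C5 * epowr m p"
      by (simp only: C5_def epowr_mult mult.assoc)
    have "C5 * epowr m p < top"
      using K m unfolding C5_def C_def by (auto simp: less_top[symmetric] ennreal_mult_eq_top_iff)
    then have "epowr S (p - 1) * W < top"
      using Ap by (rule order_le_less_trans[rotated])
    \<comment> \<open>Integrability of the dual weight on 5B comes out of the A-condition, as w has
      positive mass there.\<close>
    then have S_top: "S < top"
      using W by (auto simp: less_top[symmetric] ennreal_mult_eq_top_iff)
    have bT: "b \<le> T y" if "y \<in> ?B" for y
    proof -
      have "(\<integral>\<^sup>+z\<in>?B. ?k z * ?s z \<partial>lebesgue) = A"
        unfolding A_def
      proof (rule nn_integral_cong_AE, use w_pos in eventually_elim)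
        fix z assume z: "0 < w z"
        have "\<bar>f z\<bar> * w z powr (1 / (p - 1)) * w z powr (- 1 / (p - 1)) = \<bar>f z\<bar>"
          using z by (simp add: powr_minus)
        then show "?k z * ?s z * indicator ?B z = ennreal \<bar>f z\<bar> * indicator ?B z"
          by (simp only: ennreal_mult[symmetric] abs_ge_zero powr_ge_zero mult_nonneg_nonneg)
      qed
      then have "b = (\<integral>\<^sup>+z\<in>?B. ?k z * ?s z \<partial>lebesgue) / S"
        by (simp only: b_def)
      also have "\<dots> \<le> T y"
        unfolding T_def dilated_maximal_def S_def c_def r_def
        using i that by (intro SUP_upper) (auto simp: c_def r_def)
      finally show ?thesis .
    qed
    have "epowr b (p - 1) * m = (\<integral>\<^sup>+y. epowr b (p - 1) * indicator ?B y \<partial>lebesgue)"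
      unfolding m_def by (rule nn_integral_cmult_indicator[symmetric]) simp
    also have "\<dots> \<le> (\<integral>\<^sup>+y\<in>?B. ?g y * ennreal (w y) \<partial>lebesgue)"
    proof (rule nn_integral_mono_AE, use w_pos in eventually_elim)
      fix y assume y: "0 < w y"
      have "?g y * ennreal (w y) = epowr (T y) (p - 1)"
        using y by (simp add: ennreal_divide_times)
      then show "epowr b (p - 1) * indicator ?B y \<le> ?g y * ennreal (w y) * indicator ?B y"
        using bT[of y] p by (auto simp: indicator_def intro!: epowr_mono)
    qed
    also have "\<dots> \<le> V * W"
    proof -
      have "(\<integral>\<^sup>+y\<in>?B. ?g y * ennreal (w y) \<partial>lebesgue) / W \<le> V"
        unfolding V_def dilated_maximal_def W_def c_def r_def
        using i by (intro SUP_upper) auto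
      then show ?thesis
        by (simp only: divide_le_iff_ennreal[OF W])
    qed
    finally have bm: "epowr b (p - 1) * m \<le> V * W" .
    have AbS: "A = b * S"
      using S_pos S_top by (simp add: b_def ennreal_divide_times)
    have "epowr A (p - 1) * m = epowr b (p - 1) * m * epowr S (p - 1)"
      by (simp only: AbS epowr_mult mult_ac)
    also have "\<dots> \<le> V * W * epowr S (p - 1)"
      by (rule mult_right_mono[OF bm]) simp
    also have "\<dots> = V * (epowr S (p - 1) * W)"
      by (simp only: mult_ac)
    also have "\<dots> \<le> V * (C5 * epowr m p)"
      by (rule mult_left_mono[OF Ap]) simp
    also have "epowr m p = epowr m (p - 1) * m"
      using epowr_add[of m "p - 1" 1] by simp
    also have "V * (C5 * (epowr m (p - 1) * m)) = C5 * V * epowr m (p - 1) * m"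
      by (simp only: mult_ac)
    finally have "epowr A (p - 1) \<le> C5 * V * epowr m (p - 1)"
      using m by (rule mult_right_le_cancel_ennreal)
    moreover have "A = avg f c r * m"
      unfolding A_def m_def by (rule avg_mult_measure[OF cr(1), symmetric])
    ultimately have "epowr (avg f c r) (p - 1) * epowr m (p - 1) \<le> C5 * V * epowr m (p - 1)"
      by (simp only: epowr_mult)
    moreover have "0 < epowr m (p - 1)" "epowr m (p - 1) < top"
      using m by (auto simp: zero_less_iff_neq_zero less_top[symmetric])
    ultimately have "epowr (avg f c r) (p - 1) \<le> C5 * V"
      by (rule mult_right_le_cancel_ennreal)
    then show "avg f (fst i) (snd i) \<le> epowr (C5 * V) (1 / (p - 1))"
      using p by (simp add: epowr_le_iff c_def r_def)
  qed
  then show ?thesis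
    using p by (simp add: epowr_le_iff V_def C5_def C_def)
qed

text \<open>The outer operator acts on the Lebesgue space of w with the conjugate exponent q =
  p/(p-1), the inner one on that of \<sigma> with exponent p. The exponents fit because (T^(p-1) /
  w)^q w = T^p \<sigma> and (|f| / \<sigma>)^p \<sigma> = |f|^p w.\<close>

lemma local_maximal_strong_type:
  assumes p: "1 < p" and w: "weight w" and w_pos: "AE x in lebesgue. 0 < w x"
    and K: "A_const p \<phi> w < top" and [measurable]: "f \<in> borel_measurable lebesgue"
  shows "(\<integral>\<^sup>+x. epowr (local_maximal R f x) p * ennreal (w x) \<partial>lebesgue)
    \<le> epowr (ennreal (Q * D\<^sup>2) * epowr (A_const p \<phi> w) p * epowr (ennreal (5 ^ DIM('a))) p) (p / (p - 1))
      * ennreal (2 powr (p / (p - 1)) * (p / (p - 1)) / (p / (p - 1) - 1)) * ennreal (2 powr p * p / (p - 1))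
      * (\<integral>\<^sup>+x. epowr (absf f x) p * ennreal (w x) \<partial>lebesgue)"
proof -
  have [measurable]: "w \<in> borel_measurable lebesgue"
    using w by (rule weight_measurable)
  let ?F = "local_balls R" and ?q = "p / (p - 1)"
  let ?s = "\<lambda>y. ennreal (w y powr (- 1 / (p - 1)))"
  let ?k = "\<lambda>y. ennreal (\<bar>f y\<bar> * w y powr (1 / (p - 1)))"
  define T where "T = dilated_maximal ?F ?s ?k"
  let ?g = "\<lambda>y. epowr (T y) (p - 1) / ennreal (w y)"
  define V where "V = dilated_maximal ?F (\<lambda>y. ennreal (w y)) ?g"
  define C where "C = ennreal (Q * D\<^sup>2) * epowr (A_const p \<phi> w) p * epowr (ennreal (5 ^ DIM('a))) p"
  have [measurable]: "T \<in> borel_measurable lebesgue" "V \<in> borel_measurable lebesgue"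
    unfolding T_def V_def by measurable
  have q: "1 < ?q" "(p - 1) * ?q = p"
    using p by (auto simp: field_simps)
  have ptw: "epowr (local_maximal R f x) p \<le> epowr C ?q * epowr (V x) ?q" for x
  proof -
    have "epowr (epowr (local_maximal R f x) (p - 1)) ?q \<le> epowr (C * V x) ?q"
      unfolding C_def V_def T_def using q by (intro epowr_mono local_maximal_pointwise p w w_pos K) auto
    then show ?thesis
      by (simp only: epowr_epowr q epowr_mult)
  qed
  have "(\<integral>\<^sup>+x. epowr (local_maximal R f x) p * ennreal (w x) \<partial>lebesgue)
    \<le> (\<integral>\<^sup>+x. epowr C ?q * (epowr (V x) ?q * ennreal (w x)) \<partial>lebesgue)"
    unfolding mult.assoc[symmetric] by (intro nn_integral_mono mult_right_mono ptw) simp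
  also have "\<dots> = epowr C ?q * (\<integral>\<^sup>+x. epowr (V x) ?q * ennreal (w x) \<partial>lebesgue)"
    by (rule nn_integral_cmult) measurable
  also have "\<dots> \<le> epowr C ?q * (ennreal (2 powr ?q * ?q / (?q - 1)) * (\<integral>\<^sup>+x. epowr (?g x) ?q * ennreal (w x) \<partial>lebesgue))"
    unfolding V_def using q local_balls_radius
    by (intro mult_left_mono dilated_maximal_strong_type[where L=R]) auto
  also have "(\<integral>\<^sup>+x. epowr (?g x) ?q * ennreal (w x) \<partial>lebesgue) = (\<integral>\<^sup>+x. epowr (T x) p * ?s x \<partial>lebesgue)"
  proof (rule nn_integral_cong_AE, use w_pos in eventually_elim)
    fix x assume x: "0 < w x"
    have "epowr (?g x) ?q * ennreal (w x) = epowr (T x) p / ennreal (w x powr ?q) * ennreal (w x)"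
      using x by (simp only: epowr_divide epowr_epowr q)
    also have "\<dots> = epowr (T x) p * (ennreal (w x) / ennreal (w x powr ?q))"
      by (rule ennreal_divide_times)
    also have "ennreal (w x) / ennreal (w x powr ?q) = ?s x"
    proof -
      have "w x / w x powr ?q = w x powr (1 - ?q)"
        using x by (simp add: powr_diff)
      also have "1 - ?q = - 1 / (p - 1)"
        using p by (simp add: field_simps)
      finally show ?thesis
        using x by (simp add: divide_ennreal)
    qed
    finally show "epowr (?g x) ?q * ennreal (w x) = epowr (T x) p * ?s x" .
  qed
  also have "\<dots> \<le> ennreal (2 powr p * p / (p - 1)) * (\<integral>\<^sup>+x. epowr (?k x) p * ?s x \<partial>lebesgue)"
    unfolding T_def using p local_balls_radius
    by (intro dilated_maximal_strong_type[where L=R]) auto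
  also have "(\<integral>\<^sup>+x. epowr (?k x) p * ?s x \<partial>lebesgue) = (\<integral>\<^sup>+x. epowr (absf f x) p * ennreal (w x) \<partial>lebesgue)"
  proof (rule nn_integral_cong_AE, use w_pos in eventually_elim)
    fix x assume x: "0 < w x"
    have "(\<bar>f x\<bar> * w x powr (1 / (p - 1))) powr p * w x powr (- 1 / (p - 1))
      = \<bar>f x\<bar> powr p * (w x powr (1 / (p - 1) * p) * w x powr (- 1 / (p - 1)))"
      by (simp add: powr_mult powr_powr)
    also have "w x powr (1 / (p - 1) * p) * w x powr (- 1 / (p - 1)) = w x powr (1 / (p - 1) * p + - 1 / (p - 1))"
      by (rule powr_add[symmetric])
    also have "1 / (p - 1) * p + - 1 / (p - 1) = 1"
      using p by (simp add: diff_divide_distrib[symmetric])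
    finally have "(\<bar>f x\<bar> * w x powr (1 / (p - 1))) powr p * w x powr (- 1 / (p - 1)) = \<bar>f x\<bar> powr p * w x"
      using x by simp
    then show "epowr (?k x) p * ?s x = epowr (absf f x) p * ennreal (w x)"
      using x by (simp add: epowr_ennreal flip: ennreal_mult)
  qed
  finally show ?thesis
    by (simp add: C_def mult.assoc mult_left_mono)
qed

lemma maximal_strong_type:
  assumes p: "1 < p" and w: "weight w" and K: "A_const p \<phi> w < top"
    and fin: "\<And>B. is_ball B \<Longrightarrow> LM_norm p \<phi> w (absf (indicator B)) < top"
  obtains C :: real where "\<And>f. f \<in> borel_measurable lebesgue \<Longrightarrow> LM_norm p \<phi> w (absf f) < top \<Longrightarrow>
    LM_norm p \<phi> w (maximal f) \<le> ennreal C * LM_norm p \<phi> w (absf f)"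
proof -
  have p0: "0 < p"
    using p by simp
  have wm [measurable]: "w \<in> borel_measurable lebesgue" and w0: "\<And>x. 0 \<le> w x"
    using w by (auto simp: weight_def)
  from weight_AE_zero_or_pos[OF p0 wm w0 K] show ?thesis
  proof
    \<comment> \<open>Here every local Morrey norm is 0, so the constant 0 will do.\<close>
    assume zero: "AE x in lebesgue. w x = 0"
    have "LM_norm p \<phi> w g \<le> 0" for g
      unfolding LM_norm_le_iff[OF p0]
    proof (intro allI impI)
      fix R :: real
      have "(\<integral>\<^sup>+x\<in>ball 0 R. epowr (g x) p * ennreal (w x) \<partial>lebesgue) = (\<integral>\<^sup>+(x::'a). 0 \<partial>lebesgue)"
        by (rule nn_integral_cong_AE, use zero in eventually_elim) simp
      then show "(\<integral>\<^sup>+x\<in>ball 0 R. epowr (g x) p * ennreal (w x) \<partial>lebesgue) \<le> epowr 0 p * ennreal (\<phi> (ball 0 R))"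
        by simp
    qed
    then show ?thesis
      by (intro that[of 0]) simp
  next
    assume w_pos: "AE x in lebesgue. 0 < w x"
    define K' where "K' = A_const p \<phi> w"
    define C1 where "C1 = epowr (ennreal (Q * D\<^sup>2) * epowr K' p * epowr (ennreal (5 ^ DIM('a))) p) (p / (p - 1))
      * ennreal (2 powr (p / (p - 1)) * (p / (p - 1)) / (p / (p - 1) - 1)) * ennreal (2 powr p * p / (p - 1))"
    define C2 where "C2 = (\<Sum>j. ennreal (((1 / 2) powr \<epsilon>) ^ j)) * ennreal Q * epowr (ennreal (2 ^ DIM('a)) * K' * K') p"
    define C where "C = C1 * ennreal D + epowr (ennreal (17 ^ DIM('a))) p * C2"
    have "C < top"
      using K geometric_finite unfolding C_def C1_def C2_def K'_def
      by (auto simp: less_top[symmetric] ennreal_mult_eq_top_iff)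
    then obtain k where k: "epowr C (1 / p) = ennreal k"
      by (cases "epowr C (1 / p)") auto
    show ?thesis
    proof (rule that)
      fix f :: "'a \<Rightarrow> real"
      assume fm [measurable]: "f \<in> borel_measurable lebesgue" and f: "LM_norm p \<phi> w (absf f) < top"
      define n where "n = epowr (LM_norm p \<phi> w (absf f)) p"
      have "LM_norm p \<phi> w (maximal f) \<le> epowr C (1 / p) * LM_norm p \<phi> w (absf f)"
        unfolding LM_norm_le_iff[OF p0]
      proof (intro allI impI)
        fix R :: real assume R: "0 < R"
        \<comment> \<open>The bound for the local part integrates over the whole space, where f
          itself need not be integrable; the cut-off leaves the means over local balls
          unchanged.\<close>
        let ?h = "\<lambda>x. f x * indicator (ball 0 (2 * R)) x"
        have ptw: "epowr (maximal f x) p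
          \<le> epowr (local_maximal R ?h x) p + epowr (ennreal (17 ^ DIM('a))) p * epowr (central_maximal f x) p"
          if x: "x \<in> ball 0 R" for x
        proof -
          have "maximal f x \<le> max (local_maximal R ?h x) (ennreal (17 ^ DIM('a)) * central_maximal f x)"
            unfolding maximal_eq_SUP_avg
          proof (rule SUP_least)
            fix i assume i: "i \<in> {i. 0 < snd i \<and> x \<in> ball (fst i) (snd i)}"
            then have "i \<in> local_balls R \<or> avg f (fst i) (snd i) \<le> ennreal (17 ^ DIM('a)) * central_maximal f x"
              by (intro avg_local_or_central x) auto
            then show "avg f (fst i) (snd i) \<le> max (local_maximal R ?h x) (ennreal (17 ^ DIM('a)) * central_maximal f x)"
            proof
              assume iR: "i \<in> local_balls R"
              have "(\<integral>\<^sup>+y\<in>ball (fst i) (snd i). ennreal \<bar>f y\<bar> \<partial>lebesgue)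
                = (\<integral>\<^sup>+y\<in>ball (fst i) (snd i). ennreal \<bar>?h y\<bar> \<partial>lebesgue)"
                using local_balls_subset[OF iR] by (intro nn_integral_cong) (auto simp: indicator_def)
              then have "avg f (fst i) (snd i) = avg ?h (fst i) (snd i)"
                by (simp only: avg_def)
              also have "\<dots> \<le> local_maximal R ?h x"
                unfolding local_maximal_def using i iR by (intro SUP_upper) auto
              finally show ?thesis
                by (rule max.coboundedI1)
            qed (rule max.coboundedI2)
          qed
          then have "epowr (maximal f x) p
            \<le> epowr (max (local_maximal R ?h x) (ennreal (17 ^ DIM('a)) * central_maximal f x)) p"
            using p by (intro epowr_mono) auto
          also have "\<dots> \<le> epowr (local_maximal R ?h x) p + epowr (ennreal (17 ^ DIM('a)) * central_maximal f x) p"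
            by (simp add: max_def)
          finally show ?thesis
            by (simp only: epowr_mult)
        qed
        have "(\<integral>\<^sup>+x\<in>ball 0 R. epowr (maximal f x) p * ennreal (w x) \<partial>lebesgue)
          \<le> (\<integral>\<^sup>+x. epowr (local_maximal R ?h x) p * ennreal (w x)
              + epowr (ennreal (17 ^ DIM('a))) p * (epowr (central_maximal f x) p * ennreal (w x) * indicator (ball 0 R) x) \<partial>lebesgue)"
        proof (rule nn_integral_mono)
          fix x
          show "epowr (maximal f x) p * ennreal (w x) * indicator (ball 0 R) x
            \<le> epowr (local_maximal R ?h x) p * ennreal (w x)
              + epowr (ennreal (17 ^ DIM('a))) p * (epowr (central_maximal f x) p * ennreal (w x) * indicator (ball 0 R) x)"
          proof (cases "x \<in> ball 0 R")
            case True
            have "epowr (maximal f x) p * ennreal (w x) \<le> (epowr (local_maximal R ?h x) p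
              + epowr (ennreal (17 ^ DIM('a))) p * epowr (central_maximal f x) p) * ennreal (w x)"
              by (intro mult_right_mono ptw True) simp
            also have "\<dots> = epowr (local_maximal R ?h x) p * ennreal (w x)
              + epowr (ennreal (17 ^ DIM('a))) p * (epowr (central_maximal f x) p * ennreal (w x))"
              by (simp only: distrib_right mult.assoc)
            finally show ?thesis
              using True by simp
          qed simp
        qed
        also have "\<dots> = (\<integral>\<^sup>+x. epowr (local_maximal R ?h x) p * ennreal (w x) \<partial>lebesgue)
          + (\<integral>\<^sup>+x. epowr (ennreal (17 ^ DIM('a))) p * (epowr (central_maximal f x) p * ennreal (w x) * indicator (ball 0 R) x) \<partial>lebesgue)"
          by (rule nn_integral_add) measurable
        also have "(\<integral>\<^sup>+x. epowr (ennreal (17 ^ DIM('a))) p * (epowr (central_maximal f x) p * ennreal (w x) * indicator (ball 0 R) x) \<partial>lebesgue)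
          = epowr (ennreal (17 ^ DIM('a))) p * (\<integral>\<^sup>+x\<in>ball 0 R. epowr (central_maximal f x) p * ennreal (w x) \<partial>lebesgue)"
          by (rule nn_integral_cmult) measurable
        also have "(\<integral>\<^sup>+x. epowr (local_maximal R ?h x) p * ennreal (w x) \<partial>lebesgue)
            + epowr (ennreal (17 ^ DIM('a))) p * (\<integral>\<^sup>+x\<in>ball 0 R. epowr (central_maximal f x) p * ennreal (w x) \<partial>lebesgue)
          \<le> C1 * ennreal D * n * ennreal (\<phi> (ball 0 R)) + epowr (ennreal (17 ^ DIM('a))) p * (C2 * n * ennreal (\<phi> (ball 0 R)))"
        proof (intro add_mono mult_left_mono)
          have "(\<integral>\<^sup>+x. epowr (local_maximal R ?h x) p * ennreal (w x) \<partial>lebesgue)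
            \<le> C1 * (\<integral>\<^sup>+x. epowr (absf ?h x) p * ennreal (w x) \<partial>lebesgue)"
            unfolding C1_def K'_def by (rule local_maximal_strong_type[OF p w w_pos K]) measurable
          also have "(\<integral>\<^sup>+x. epowr (absf ?h x) p * ennreal (w x) \<partial>lebesgue)
            = (\<integral>\<^sup>+x\<in>ball 0 (2 * R). epowr (absf f x) p * ennreal (w x) \<partial>lebesgue)"
            by (intro nn_integral_cong) (auto simp: indicator_def)
          also have "C1 * \<dots> \<le> C1 * (n * ennreal (D * \<phi> (ball 0 R)))"
          proof (rule mult_left_mono)
            have "(\<integral>\<^sup>+x\<in>ball 0 (2 * R). epowr (absf f x) p * ennreal (w x) \<partial>lebesgue) \<le> n * ennreal (\<phi> (ball 0 (2 * R)))"
              unfolding n_def using R by (intro nn_integral_le_LM_norm p0) simp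
            also have "\<dots> \<le> n * ennreal (D * \<phi> (ball 0 R))"
              by (intro mult_left_mono ennreal_leI \<phi>_doubling R) simp
            finally show "(\<integral>\<^sup>+x\<in>ball 0 (2 * R). epowr (absf f x) p * ennreal (w x) \<partial>lebesgue) \<le> n * ennreal (D * \<phi> (ball 0 R))" .
          qed simp
          also have "\<dots> = C1 * ennreal D * n * ennreal (\<phi> (ball 0 R))"
            using D_pos \<phi>_pos[OF R] by (simp add: ennreal_mult mult_ac)
          finally show "(\<integral>\<^sup>+x. epowr (local_maximal R ?h x) p * ennreal (w x) \<partial>lebesgue)
            \<le> C1 * ennreal D * n * ennreal (\<phi> (ball 0 R))" .
          have "(\<integral>\<^sup>+x\<in>ball 0 R. epowr (central_maximal f x) p * ennreal (w x) \<partial>lebesgue)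
            \<le> (\<Sum>j. ennreal (((1 / 2) powr \<epsilon>) ^ j)) * ennreal Q
              * epowr (ennreal (2 ^ DIM('a)) * K' * (K' * LM_norm p \<phi> w (absf f))) p * ennreal (\<phi> (ball 0 R))"
            unfolding K'_def by (rule central_maximal_strong_type[OF p0 wm fm K f R fin])
          then show "(\<integral>\<^sup>+x\<in>ball 0 R. epowr (central_maximal f x) p * ennreal (w x) \<partial>lebesgue) \<le> C2 * n * ennreal (\<phi> (ball 0 R))"
            by (simp only: C2_def n_def epowr_mult mult_ac)
        qed simp
        also have "\<dots> = C * n * ennreal (\<phi> (ball 0 R))"
          by (simp only: C_def distrib_right mult.assoc)
        also have "C * n = epowr (epowr C (1 / p) * LM_norm p \<phi> w (absf f)) p"
          using p by (simp add: n_def epowr_mult epowr_epowr)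
        finally show "(\<integral>\<^sup>+x\<in>ball 0 R. epowr (maximal f x) p * ennreal (w x) \<partial>lebesgue)
          \<le> epowr (epowr C (1 / p) * LM_norm p \<phi> w (absf f)) p * ennreal (\<phi> (ball 0 R))" .
      qed
      then show "LM_norm p \<phi> w (maximal f) \<le> ennreal k * LM_norm p \<phi> w (absf f)"
        by (simp only: k)
    qed
  qed
qed

section \<open>Boundedness, the A-class and the operator norm\<close>

lemma M_bounded_LM_imp_WLM:
  assumes "0 < p" "w \<in> borel_measurable lebesgue" "M_bounded_LM p \<phi> w"
  shows "M_bounded_WLM p \<phi> w"
proof -
  obtain C :: real where C: "\<And>f. f \<in> borel_measurable lebesgue \<Longrightarrow> LM_norm p \<phi> w (absf f) < top \<Longrightarrow>
      LM_norm p \<phi> w (maximal f) \<le> ennreal C * LM_norm p \<phi> w (absf f)"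
    using assms(3) unfolding M_bounded_LM_def by blast
  have "WLM_norm p \<phi> w (maximal f) \<le> LM_norm p \<phi> w (maximal f)" for f
    using assms by (intro WLM_norm_le_LM_norm) auto
  then show ?thesis
    unfolding M_bounded_WLM_def using C by (meson order_trans)
qed

lemma M_bounded_WLM_imp_A_class:
  assumes p: "0 < p" and "M_bounded_WLM p \<phi> w"
  shows "A_class p \<phi> w"
proof -
  obtain C :: real where C: "\<And>f. f \<in> borel_measurable lebesgue \<Longrightarrow> LM_norm p \<phi> w (absf f) < top \<Longrightarrow>
      WLM_norm p \<phi> w (maximal f) \<le> ennreal C * LM_norm p \<phi> w (absf f)"
    using assms(2) unfolding M_bounded_WLM_def by blast
  have "M_opnorm_WLM p \<phi> w \<le> ennreal C"
    unfolding M_opnorm_WLM_def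
  proof (rule SUP_least)
    fix f assume f: "f \<in> {f \<in> borel_measurable lebesgue. LM_norm p \<phi> w (absf f) \<le> 1}"
    then have "WLM_norm p \<phi> w (maximal f) \<le> ennreal C * LM_norm p \<phi> w (absf f)"
      by (intro C) (auto intro: order_le_less_trans)
    also have "\<dots> \<le> ennreal C * 1"
      using f by (intro mult_left_mono) auto
    finally show "WLM_norm p \<phi> w (maximal f) \<le> ennreal C"
      by simp
  qed
  with A_const_le_opnorm[OF p, of w] have "A_const p \<phi> w \<le> ennreal C"
    by (rule order_trans)
  then show ?thesis
    unfolding A_class_def by (rule order_le_less_trans) simp
qed

text \<open>The second summand of \<open>weak_constant\<close> is positive. Positivity matters when
  the A-constant is \<open>top\<close>, where k times it must be \<open>top\<close> as well.\<close>

lemma weak_constant_real: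
  assumes "0 < p"
  obtains k where "0 < k" "epowr (weak_constant p) (1 / p) = ennreal k"
proof -
  have "weak_constant p \<noteq> top"
    by (auto simp: weak_constant_def ennreal_mult_eq_top_iff)
  then obtain k where k: "0 \<le> k" "epowr (weak_constant p) (1 / p) = ennreal k"
    by (cases "epowr (weak_constant p) (1 / p)") auto
  moreover have "epowr (weak_constant p) (1 / p) \<noteq> 0"
    by (simp add: weak_constant_def)
  ultimately have "0 < k"
    by (cases "k = 0") auto
  then show ?thesis
    using k(2) by (rule that)
qed

lemma A_class_imp_M_bounded_WLM:
  assumes p: "0 < p" and w: "w \<in> borel_measurable lebesgue" and "A_class p \<phi> w"
  shows "M_bounded_WLM p \<phi> w"
proof -
  have K: "A_const p \<phi> w < top"
    using assms(3) by (simp add: A_class_def)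
  then obtain a where a: "A_const p \<phi> w = ennreal a" "0 \<le> a"
    by (cases "A_const p \<phi> w") auto
  obtain k where k: "0 < k" "epowr (weak_constant p) (1 / p) = ennreal k"
    using weak_constant_real[OF p] .
  have "WLM_norm p \<phi> w (maximal f) \<le> ennreal (k * a) * LM_norm p \<phi> w (absf f)"
    if "f \<in> borel_measurable lebesgue" "LM_norm p \<phi> w (absf f) < top" for f
    using maximal_weak_type[OF p w that(1) K that(2)] a k by (simp add: ennreal_mult mult.assoc)
  then show ?thesis
    unfolding M_bounded_WLM_def by blast
qed

lemma opnorm_le_A_const:
  assumes p: "0 < p" and w: "w \<in> borel_measurable lebesgue"
    and k: "0 < k" "epowr (weak_constant p) (1 / p) = ennreal k"
  shows "M_opnorm_WLM p \<phi> w \<le> ennreal k * A_const p \<phi> w"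
proof (cases "A_const p \<phi> w = top")
  case True
  then show ?thesis
    using k by (simp add: ennreal_mult_top)
next
  case False
  then have K: "A_const p \<phi> w < top"
    by (simp add: less_top)
  show ?thesis
    unfolding M_opnorm_WLM_def
  proof (rule SUP_least)
    fix f assume f: "f \<in> {f \<in> borel_measurable lebesgue. LM_norm p \<phi> w (absf f) \<le> 1}"
    then have "WLM_norm p \<phi> w (maximal f) \<le> ennreal k * (A_const p \<phi> w * LM_norm p \<phi> w (absf f))"
      unfolding k(2)[symmetric] by (intro maximal_weak_type p w K) (auto intro: order_le_less_trans)
    also have "\<dots> \<le> ennreal k * (A_const p \<phi> w * 1)"
      using f by (intro mult_left_mono) auto
    finally show "WLM_norm p \<phi> w (maximal f) \<le> ennreal k * A_const p \<phi> w"
      by simp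
  qed
qed

end

text \<open>The volume ratio of two central balls is (s / R)^n, so the exponent \<delta> for volumes
  becomes n \<delta> for radii.\<close>

lemma admissible_phi_radial_growth:
  fixes \<phi> :: "'a::euclidean_space set \<Rightarrow> real"
  assumes "admissible_phi \<phi>"
  obtains D Q \<epsilon> where "radial_growth \<phi> D Q \<epsilon>"
proof -
  note adm = assms[unfolded admissible_phi_def]
  have pos: "0 < \<phi> B" if "is_ball B" for B
    using adm that by simp
  obtain D where dbl: "\<And>c r. 0 < r \<Longrightarrow> \<phi> (ball c (2 * r)) \<le> D * \<phi> (ball c r)"
    using adm[THEN conjunct2, THEN conjunct1] by auto
  obtain \<delta> C where \<delta>: "0 < \<delta>"
    and rev: "\<forall>B1 B2. is_ball B1 \<longrightarrow> is_ball B2 \<longrightarrow> B1 \<subseteq> B2 \<longrightarrow>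
        \<phi> B1 / \<phi> B2 \<le> C * (measure lebesgue B1 / measure lebesgue B2) powr \<delta>"
    using adm[THEN conjunct2, THEN conjunct2] by blast
  have "radial_growth \<phi> D C (real DIM('a) * \<delta>)"
  proof
    fix s R :: real assume sR: "0 < s" "s \<le> R"
    then have R: "0 < R"
      by simp
    have "measure lebesgue (ball (0::'a) s) / measure lebesgue (ball (0::'a) R) = (s / R) ^ DIM('a)"
      using sR content_ball[of s "0::'a"] content_ball[of R "0::'a"] 
        unit_ball_vol_pos[of "real DIM('a)"]
      by (auto simp: power_divide)
    then have "(measure lebesgue (ball (0::'a) s) / measure lebesgue (ball (0::'a) R)) powr \<delta>
      = (s / R) powr (real DIM('a) * \<delta>)"
      using sR by (simp add: powr_powr[symmetric] powr_realpow)
    moreover have "\<phi> (ball 0 s) / \<phi> (ball 0 R)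
      \<le> C * (measure lebesgue (ball (0::'a) s) / measure lebesgue (ball (0::'a) R)) powr \<delta>"
      using sR by (intro rev[rule_format] is_ball_ball subset_ball) auto
    ultimately show "\<phi> (ball 0 s) \<le> C * (s / R) powr (real DIM('a) * \<delta>) * \<phi> (ball 0 R)"
      using pos[OF is_ball_ball[OF R]] by (simp add: pos_divide_le_eq)
  qed (use dbl \<delta> pos[OF is_ball_ball] in auto)
  then show ?thesis
    by (rule that)
qed

theorem theorem6p1:
  fixes \<phi> :: "'a::euclidean_space set \<Rightarrow> real"
  assumes phi: "admissible_phi \<phi>"
  shows
    "(\<forall>p w. 1 < p \<longrightarrow> weight w \<longrightarrow>
        (\<forall>B. is_ball B \<longrightarrow> LM_norm p \<phi> w (absf (indicator B)) < top) \<longrightarrow>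
        (M_bounded_LM p \<phi> w \<longleftrightarrow> A_class p \<phi> w))
     \<and>
     (\<forall>p. 1 \<le> p \<longrightarrow> (\<exists>c1 c2. 0 < c1 \<and> 0 < c2 \<and>
        (\<forall>w. weight w \<longrightarrow>
          (\<forall>B. is_ball B \<longrightarrow> LM_norm p \<phi> w (absf (indicator B)) < top) \<longrightarrow>
          (M_bounded_WLM p \<phi> w \<longleftrightarrow> A_class p \<phi> w) \<and>
          ennreal c1 * A_const p \<phi> w \<le> M_opnorm_WLM p \<phi> w \<and>
          M_opnorm_WLM p \<phi> w \<le> ennreal c2 * A_const p \<phi> w)))"
proof -
  obtain D Q \<epsilon> where "radial_growth \<phi> D Q \<epsilon>"
    using phi by (rule admissible_phi_radial_growth)
  then interpret radial_growth \<phi> D Q \<epsilon> .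
  show ?thesis
  proof (intro conjI allI impI)
    fix p w
    assume p: "1 < p" and w: "weight w"
      and fin: "\<forall>B. is_ball B \<longrightarrow> LM_norm p \<phi> w (absf (indicator B)) < top"
    show "M_bounded_LM p \<phi> w \<longleftrightarrow> A_class p \<phi> w"
    proof
      assume "M_bounded_LM p \<phi> w"
      then have "M_bounded_WLM p \<phi> w"
        using p weight_measurable[OF w] by (intro M_bounded_LM_imp_WLM) auto
      then show "A_class p \<phi> w"
        using p by (intro M_bounded_WLM_imp_A_class) auto
    next
      assume "A_class p \<phi> w"
      then have K: "A_const p \<phi> w < top"
        by (simp add: A_class_def)
      obtain C :: real where "\<And>f. f \<in> borel_measurable lebesgue \<Longrightarrow> LM_norm p \<phi> w (absf f) < top \<Longrightarrow>
          LM_norm p \<phi> w (maximal f) \<le> ennreal C * LM_norm p \<phi> w (absf f)"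
        using maximal_strong_type[OF p w K] fin by blast
      then show "M_bounded_LM p \<phi> w"
        unfolding M_bounded_LM_def by blast
    qed
  next
    fix p :: real assume "1 \<le> p"
    then have p: "0 < p"
      by simp
    obtain k where k: "0 < k" "epowr (weak_constant p) (1 / p) = ennreal k"
      using weak_constant_real[OF p] .
    show "\<exists>c1 c2. 0 < c1 \<and> 0 < c2 \<and>
        (\<forall>w. weight w \<longrightarrow>
          (\<forall>B. is_ball B \<longrightarrow> LM_norm p \<phi> w (absf (indicator B)) < top) \<longrightarrow>
          (M_bounded_WLM p \<phi> w \<longleftrightarrow> A_class p \<phi> w) \<and>
          ennreal c1 * A_const p \<phi> w \<le> M_opnorm_WLM p \<phi> w \<and>
          M_opnorm_WLM p \<phi> w \<le> ennreal c2 * A_const p \<phi> w)"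
    \<comment> \<open>The lower constant is 1. The upper constant k is fixed before w: it depends
      only on p, the dimension and the growth constants of \<phi>.\<close>
    proof (rule exI[of _ 1], rule exI[of _ k], intro conjI allI impI)
      fix w :: "'a \<Rightarrow> real" assume w: "weight w"
      note wm = weight_measurable[OF w]
      show "M_bounded_WLM p \<phi> w \<longleftrightarrow> A_class p \<phi> w"
        using M_bounded_WLM_imp_A_class[OF p] A_class_imp_M_bounded_WLM[OF p wm] by blast
      show "ennreal 1 * A_const p \<phi> w \<le> M_opnorm_WLM p \<phi> w"
        using A_const_le_opnorm[OF p, of w] by simp
      show "M_opnorm_WLM p \<phi> w \<le> ennreal k * A_const p \<phi> w"
        by (rule opnorm_le_A_const[OF p wm k])
    qed (use k in auto)
  qed
qed

end
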